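(* Let $m\in\mathbb Z^+$ and $\mathcal D_{2m}=\{(z,w)\in\mathbb C^2:|z|^2+|w|^{2m}<1\}$. Let $\varpi_{\mathrm F}$ denote the weight function of the Fefferman surface area measure $\sigma_{\mathrm F}$ on $\partial\mathcal D_{2m}$, i.e. $d\sigma_{\mathrm F}=\varpi_{\mathrm F}\,d\sigma_{\mathrm E}$. Then $\varpi_{\mathrm F}$ belongs to the Muckenhoupt class $A_2(\partial\mathcal D_{2m})=A_2(\partial\mathcal D_{2m},d,dS)$.
   Context: Put $\rho(z,w)=|z|^2+|w|^{2m}-1$, and let $\sigma_{\mathrm E}$ be the Euclidean surface measure on $\partial\mathcal D_{2m}$. Fefferman weight: on the boundary of a bounded $C^2$-smooth domain $\{\rho<0\}\subset\mathbb C^n$, $d\sigma_{\mathrm F}=\varpi_{\mathrm F}\,d\sigma_{\mathrm E}$ with $$\varpi_{\mathrm F}=\frac1{|d\rho|}\left|\det\begin{pmatrix}\rho&\partial_{\bar j}\rho\\ \partial_i\rho&\partial_i\partial_{\bar j}\rho\end{pmatrix}_{1\le i,j\le n}\right|^{\frac1{n+1}},\qquad |d\rho|=\Big(\sum_j|\partial_j\rho|^2\Big)^{1/2}.$$ For $\mathcal D_{2m}$ and $\rho(z,w)=|z|^2+|w|^{2m}-1$ this is $\varpi_{\mathrm F}(z,w)=\dfrac{(m^2|w|^{2m-2})^{1/3}}{\sqrt{|z|^2+m^2|w|^{4m-2}}}$. Quasimetric: for $\zeta=(z,w)$, $\eta=(z_0,w_0)\in\partial\mathcal D_{2m}$, put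 $v(\zeta,\eta)=\bar z(z-z_0)+m\bar w|w|^{2m-2}(w-w_0)$ and $d(\zeta,\eta)=|v(\zeta,\eta)|+|v(\eta,\zeta)|$. Quasimetric balls are $\mathrm B_d(\zeta,r)=\{\eta\in\partial\mathcal D_{2m}:d(\zeta,\eta)<r\}$. Measure: $dS=(2\pi i)^{-2}\,\partial\rho\wedge\bar\partial\partial\rho$ restricted to $\partial\mathcal D_{2m}$, regarded as a positive measure. The triple $(\partial\mathcal D_{2m},d,dS)$ is a space of homogeneous type. Muckenhoupt class: for a space of homogeneous type $(X,d,\mu)$, a nonnegative locally integrable function $\varpi$ on $X$ belongs to $A_2(X,d,\mu)$ if $$\sup_{\mathrm B}\left(\frac1{\mu(\mathrm B)}\int_{\mathrm B}\varpi\,d\mu\right)\left(\frac1{\mu(\mathrm B)}\int_{\mathrm B}\varpi^{-1}\,d\mu\right)<\infty,$$ the supremum being over all quasimetric balls $\mathrm B\subset X$ with $0<\mu(\mathrm B)<\infty$. *)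

theory Defs
  imports "HOL-Analysis.Analysis"
begin

section \<open>Wirtinger derivatives and the Fefferman weight\<close>

definition dir_deriv :: "('a::real_normed_vector \<Rightarrow> 'b::real_normed_vector) \<Rightarrow> 'a \<Rightarrow> 'a \<Rightarrow> 'b"
  where "dir_deriv f v p = vector_derivative (\<lambda>t. f (p + t *\<^sub>R v)) (at 0)"

definition wirt :: "'n \<Rightarrow> (complex ^ 'n \<Rightarrow> complex) \<Rightarrow> complex ^ 'n \<Rightarrow> complex"
  where "wirt j f p = (dir_deriv f (axis j 1) p - \<i> * dir_deriv f (axis j \<i>) p) / 2"

definition wirt_bar :: "'n \<Rightarrow> (complex ^ 'n \<Rightarrow> complex) \<Rightarrow> complex ^ 'n \<Rightarrow> complex"
  where "wirt_bar j f p = (dir_deriv f (axis j 1) p + \<i> * dir_deriv f (axis j \<i>) p) / 2"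

text \<open>The bordered complex Hessian; the index \<^const>\<open>None\<close> is the border.\<close>

definition bordered_hessian ::
    "(complex ^ 'n \<Rightarrow> real) \<Rightarrow> complex ^ 'n \<Rightarrow> complex ^ 'n option ^ 'n option"
  where "bordered_hessian \<rho> p = (\<chi> a b.
    (case a of
       None \<Rightarrow> (case b of
          None \<Rightarrow> of_real (\<rho> p)
        | Some j \<Rightarrow> wirt_bar j (\<lambda>q. of_real (\<rho> q)) p)
     | Some i \<Rightarrow> (case b of
          None \<Rightarrow> wirt i (\<lambda>q. of_real (\<rho> q)) p
        | Some j \<Rightarrow> wirt i (wirt_bar j (\<lambda>q. of_real (\<rho> q))) p)))"

definition fefferman_weight :: "(complex ^ 'n::finite \<Rightarrow> real) \<Rightarrow> complex ^ 'n \<Rightarrow> real"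
  where "fefferman_weight \<rho> p =
    1 / sqrt (\<Sum>j\<in>UNIV. (cmod (wirt j (\<lambda>q. of_real (\<rho> q)) p))\<^sup>2)
    * cmod (det (bordered_hessian \<rho> p)) powr (1 / (real CARD('n) + 1))"

section \<open>The positive measure induced by a 3-form on a hypersurface\<close>

text \<open>A \<open>k\<close>-form on a real vector space is a function of the base point and of \<open>k\<close> tangent
  vectors; wedge products are normalised by
  \<open>(dx\<^sub>1 \<and> \<dots> \<and> dx\<^sub>k) (e\<^sub>1, \<dots>, e\<^sub>k) = 1\<close>.\<close>

definition del_form :: "(complex ^ 'n::finite \<Rightarrow> real) \<Rightarrow> complex ^ 'n \<Rightarrow> complex ^ 'n \<Rightarrow> complex"
  where "del_form \<rho> p v = (\<Sum>j\<in>UNIV. wirt j (\<lambda>q. of_real (\<rho> q)) p * v $ j)"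

text \<open>\<open>\<partial>\<^bsup>bar\<^esup>\<partial>\<rho> = \<Sum>\<^sub>j\<^sub>k (\<partial>\<^bsup>bar\<^esup>\<^sub>k \<partial>\<^sub>j \<rho>) dz\<^bsup>bar\<^esup>\<^sub>k \<and> dz\<^sub>j\<close>.\<close>

definition delbar_del_form ::
    "(complex ^ 'n::finite \<Rightarrow> real) \<Rightarrow> complex ^ 'n \<Rightarrow> complex ^ 'n \<Rightarrow> complex ^ 'n \<Rightarrow> complex"
  where "delbar_del_form \<rho> p u v = (\<Sum>j\<in>UNIV. \<Sum>k\<in>UNIV.
    wirt_bar k (wirt j (\<lambda>q. of_real (\<rho> q))) p * (cnj (u $ k) * v $ j - cnj (v $ k) * u $ j))"

definition wedge12 ::
    "('a \<Rightarrow> 'a \<Rightarrow> complex) \<Rightarrow> ('a \<Rightarrow> 'a \<Rightarrow> 'a \<Rightarrow> complex) \<Rightarrow> 'a \<Rightarrow> 'a \<Rightarrow> 'a \<Rightarrow> 'a \<Rightarrow> complex"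
  where "wedge12 \<alpha> \<beta> p u v w = \<alpha> p u * \<beta> p v w - \<alpha> p v * \<beta> p u w + \<alpha> p w * \<beta> p u v"

definition leray_levi_form ::
    "(complex ^ 2 \<Rightarrow> real) \<Rightarrow> complex ^ 2 \<Rightarrow> complex ^ 2 \<Rightarrow> complex ^ 2 \<Rightarrow> complex ^ 2 \<Rightarrow> complex"
  where "leray_levi_form \<rho> p u v w =
    wedge12 (del_form \<rho>) (delbar_del_form \<rho>) p u v w / (2 * of_real pi * \<i>)\<^sup>2"

text \<open>\<open>C\<^sup>1\<close> local parametrisations \<open>\<phi> : U \<rightarrow> M\<close> of a 3-dimensional submanifold \<open>M\<close>.\<close>

definition local_param3 :: "'a::euclidean_space set \<Rightarrow> (real ^ 3) set \<Rightarrow> (real ^ 3 \<Rightarrow> 'a) \<Rightarrow> bool"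
  where "local_param3 M U \<phi> \<longleftrightarrow>
    open U \<and> inj_on \<phi> U \<and> \<phi> ` U \<subseteq> M \<and>
    (\<forall>u\<in>U. \<phi> differentiable (at u) \<and> inj (frechet_derivative \<phi> (at u))) \<and>
    (\<forall>v. continuous_on U (\<lambda>u. frechet_derivative \<phi> (at u) v))"

definition pullback3 ::
    "('a::euclidean_space \<Rightarrow> 'a \<Rightarrow> 'a \<Rightarrow> 'a \<Rightarrow> complex) \<Rightarrow> (real ^ 3 \<Rightarrow> 'a) \<Rightarrow> real ^ 3 \<Rightarrow> complex"
  where "pullback3 \<omega> \<phi> u = \<omega> (\<phi> u)
    (frechet_derivative \<phi> (at u) (axis 1 1))
    (frechet_derivative \<phi> (at u) (axis 2 1))
    (frechet_derivative \<phi> (at u) (axis 3 1))"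

text \<open>The 3-form \<open>\<omega>\<close> restricted to \<open>M\<close> and regarded as a positive measure: the Borel measure on
  \<open>M\<close> given in every local parametrisation by the density \<open>\<bar>\<phi>\<^sup>*\<omega>\<bar>\<close>. By the change of variables
  formula it exists and is unique whenever \<open>M\<close> is a 3-dimensional \<open>C\<^sup>1\<close> submanifold and \<open>\<omega>\<close> is a continuous form.\<close>

definition is_form_measure ::
    "'a::euclidean_space set \<Rightarrow> ('a \<Rightarrow> 'a \<Rightarrow> 'a \<Rightarrow> 'a \<Rightarrow> complex) \<Rightarrow> 'a measure \<Rightarrow> bool"
  where "is_form_measure M \<omega> \<mu> \<longleftrightarrow>
    sets \<mu> = sets (restrict_space borel M) \<and>
    (\<forall>U \<phi>. local_param3 M U \<phi> \<longrightarrow> (\<forall>A\<in>sets borel.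
       emeasure \<mu> (A \<inter> \<phi> ` U) =
         (\<integral>\<^sup>+u\<in>U. indicator A (\<phi> u) * ennreal (cmod (pullback3 \<omega> \<phi> u)) \<partial>lborel)))"

definition form_measure ::
    "'a::euclidean_space set \<Rightarrow> ('a \<Rightarrow> 'a \<Rightarrow> 'a \<Rightarrow> 'a \<Rightarrow> complex) \<Rightarrow> 'a measure"
  where "form_measure M \<omega> = (THE \<mu>. is_form_measure M \<omega> \<mu>)"

section \<open>The Muckenhoupt class\<close>

definition qball :: "'a set \<Rightarrow> ('a \<Rightarrow> 'a \<Rightarrow> real) \<Rightarrow> 'a \<Rightarrow> real \<Rightarrow> 'a set"
  where "qball X d x r = {y \<in> X. d x y < r}"

text \<open>Averages are taken in \<^typ>\<open>ennreal\<close>, where \<open>inverse 0 = \<infinity>\<close>. Since also \<open>0 * \<infinity> = 0\<close> there, positivity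
  almost everywhere has to be demanded separately, or the zero weight would qualify.
  Local integrability means integrability over all quasimetric balls.\<close>

definition muckenhoupt_A2 ::
    "'a set \<Rightarrow> ('a \<Rightarrow> 'a \<Rightarrow> real) \<Rightarrow> 'a measure \<Rightarrow> ('a \<Rightarrow> real) set"
  where "muckenhoupt_A2 X d \<mu> = {\<omega>.
    (\<forall>x\<in>X. 0 \<le> \<omega> x) \<and>
    \<omega> \<in> borel_measurable \<mu> \<and>
    (\<forall>x\<in>X. \<forall>r>0. set_integrable \<mu> (qball X d x r) \<omega>) \<and>
    (AE x in \<mu>. 0 < \<omega> x) \<and>
    (SUP B \<in> {qball X d x r |x r. x \<in> X \<and> 0 < r \<and>
                0 < emeasure \<mu> (qball X d x r) \<and> emeasure \<mu> (qball X d x r) < \<infinity>}.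
       ((\<integral>\<^sup>+x\<in>B. ennreal (\<omega> x) \<partial>\<mu>) / emeasure \<mu> B) *
       ((\<integral>\<^sup>+x\<in>B. inverse (ennreal (\<omega> x)) \<partial>\<mu>) / emeasure \<mu> B)) < \<infinity>}"

section \<open>The domain, its quasimetric and its boundary measure\<close>

text \<open>A point \<open>(z, w)\<close> of \<open>\<complex>\<^sup>2\<close> is \<open>p\<close> with \<open>z = p $ 1\<close> and \<open>w = p $ 2\<close>.\<close>

definition egg_domain :: "nat \<Rightarrow> (complex ^ 2) set"
  where "egg_domain m = {p. (cmod (p $ 1))\<^sup>2 + cmod (p $ 2) ^ (2 * m) < 1}"

definition egg_rho :: "nat \<Rightarrow> complex ^ 2 \<Rightarrow> real"
  where "egg_rho m p = (cmod (p $ 1))\<^sup>2 + cmod (p $ 2) ^ (2 * m) - 1"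

definition egg_v :: "nat \<Rightarrow> complex ^ 2 \<Rightarrow> complex ^ 2 \<Rightarrow> complex"
  where "egg_v m \<zeta> \<eta> = cnj (\<zeta> $ 1) * (\<zeta> $ 1 - \<eta> $ 1)
    + of_nat m * cnj (\<zeta> $ 2) * of_real (cmod (\<zeta> $ 2) ^ (2 * m - 2)) * (\<zeta> $ 2 - \<eta> $ 2)"

definition egg_dist :: "nat \<Rightarrow> complex ^ 2 \<Rightarrow> complex ^ 2 \<Rightarrow> real"
  where "egg_dist m \<zeta> \<eta> = cmod (egg_v m \<zeta> \<eta>) + cmod (egg_v m \<eta> \<zeta>)"

definition egg_S :: "nat \<Rightarrow> (complex ^ 2) measure"
  where "egg_S m = form_measure (frontier (egg_domain m)) (leray_levi_form (egg_rho m))"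

end

theory Submission
  imports Defs
begin

text \<open>On the boundary, \<open>|z|\<^sup>2 + |w|\<^bsup>2m\<^esup> = 1\<close> turns both the bordered determinant and the density of
  \<open>dS\<close> in the coordinates \<open>(w, arg z)\<close> into constant multiples of \<open>|w|\<^bsup>2m-2\<^esup>\<close>, so the weight is comparable to
  \<open>|w|\<^bsup>(2m-2)/3\<^esup>\<close>. Monotonicity of \<open>w \<mapsto> w |w|\<^bsup>2m-2\<^esup>\<close> bounds
  \<open>(|w|\<^bsup>2m-2\<^esup> + |w\<^sub>0|\<^bsup>2m-2\<^esup>) |w - w\<^sub>0|\<^sup>2\<close> by a multiple of the quasidistance. Hence on a ball of radius \<open>r\<close> with
  \<open>|w\<^sub>0|\<^bsup>2m\<^esup> \<ge> 8r\<close> the modulus of \<open>w\<close>, and thus the weight, is essentially constant. Otherwise, with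
  \<open>s = min(r, 1)\<^bsup>1/(2m)\<^esup>\<close>, the ball lies in \<open>|w| \<le> 8s\<close>, \<open>|arg z - arg z\<^sub>0| \<le> C s\<^bsup>2m\<^esup>\<close> and contains a box of
  comparable size on which \<open>|w|\<close> is comparable to \<open>s\<close>; the singularity of the inverse weight is absorbed by the
  density of \<open>dS\<close>.\<close>

section \<open>Derivatives of the defining function\<close>

text \<open>\<open>egg_S\<close> is a definite description over all C^1 parametrisations, so an
  estimate for it presupposes existence, uniqueness and a formula for integration. The formula comes
  from pushing a density forward along the single chart \<open>egg_param\<close>, which misses the
  boundary points whose z is a nonpositive real. That this candidate has the right mass in every
  parametrisation requires the missed points to have a Lebesgue null preimage under each of them.
  Uniqueness requires countably many charts covering everything, including the circle z = 0, where
  (w, arg z) fails as a chart and z and w exchange roles. The estimate near w = 0 works because the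
  scales cancel exactly. With eta = m^2 (8s)^(2m-2), the mean of the weight is at most 2 eta^(1/3),
  and the integral of its inverse is at most a multiple of eta^(2/3) s^2 s^(2m). The product is of
  order eta s^2 s^(2m), which is also the order of the lower bound for the measure of the ball, so
  the quotient depends on m alone.\<close>

lemma UNIV_option_2: "(UNIV :: 2 option set) = {None, Some 1, Some 2}"
  by (auto simp: UNIV_option_conv UNIV_2)

text \<open>Sarrus' rule with \<open>None\<close> as the border index; the six permutations are
  generated by adjoining one index at a time.\<close>

lemma det_option_2:
  fixes A :: "'a::comm_ring_1 ^ 2 option ^ 2 option"
  shows "det A =
    A $ None $ None * A $ Some 1 $ Some 1 * A $ Some 2 $ Some 2 +
    A $ None $ Some 1 * A $ Some 1 $ Some 2 * A $ Some 2 $ None +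
    A $ None $ Some 2 * A $ Some 1 $ None * A $ Some 2 $ Some 1 -
    A $ None $ None * A $ Some 1 $ Some 2 * A $ Some 2 $ Some 1 -
    A $ None $ Some 1 * A $ Some 1 $ None * A $ Some 2 $ Some 2 -
    A $ None $ Some 2 * A $ Some 1 $ Some 1 * A $ Some 2 $ None"
proof -
  have f: "finite {Some (1::2), Some 2}" "None \<notin> {Some (1::2), Some 2}"
    and g: "finite {Some (2::2)}" "Some 1 \<notin> {Some (2::2)}"
    by auto
  show ?thesis
    unfolding det_def UNIV_option_2
    unfolding sum_over_permutations_insert[OF f]
    unfolding sum_over_permutations_insert[OF g]
    unfolding permutes_sing
    by (simp add: sign_swap_id permutation_swap_id sign_compose sign_id swap_id_eq)
qed

lemma dir_deriv_has_derivative: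
  assumes "(f has_derivative F) (at p)"
  shows "dir_deriv f v p = F v"
proof -
  have "((\<lambda>t. f (p + t *\<^sub>R v)) has_derivative (\<lambda>t. F (t *\<^sub>R v))) (at 0)"
    by (rule has_derivative_compose[where g=f]) (auto intro!: derivative_eq_intros simp: assms)
  then have "((\<lambda>t. f (p + t *\<^sub>R v)) has_vector_derivative F v) (at 0)"
    unfolding has_vector_derivative_def
    by (simp add: linear_scale[OF has_derivative_linear[OF assms]])
  then show ?thesis
    unfolding dir_deriv_def by (rule vector_derivative_at)
qed

text \<open>A real-linear map splits into a complex-linear and a conjugate-linear part, and the
  Wirtinger derivatives read off the two families of coefficients. All later derivatives are
  therefore computed as Frechet derivatives in this normal form.\<close>

lemma wirt_has_derivative:
  fixes f :: "complex ^ 'n::finite \<Rightarrow> complex"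
  assumes "(f has_derivative (\<lambda>h. \<Sum>i\<in>UNIV. A i * h $ i + B i * cnj (h $ i))) (at p)"
  shows "wirt j f p = A j" and "wirt_bar j f p = B j"
proof -
  have *: "(\<Sum>i\<in>UNIV. A i * axis j c $ i + B i * cnj (axis j c $ i)) = A j * c + B j * cnj c" for c
    by (subst sum.remove[of _ j]) (auto simp: axis_def intro!: sum.neutral)
  show "wirt j f p = A j" "wirt_bar j f p = B j"
    unfolding wirt_def wirt_bar_def dir_deriv_has_derivative[OF assms] *
    by (auto simp: algebra_simps)
qed

text \<open>As |w|^(2m) is w^m times its conjugate, both rho and its Wirtinger gradient are built
  from such monomials in one coordinate, so this rule serves for both orders of differentiation. For
  a = 0 or b = 0 the truncated exponent is harmless because its coefficient vanishes.\<close>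

lemma has_derivative_monomial:
  fixes p :: "complex ^ 2"
  shows "((\<lambda>q. c * (q $ i) ^ a * cnj (q $ i) ^ b) has_derivative
    (\<lambda>h. \<Sum>k\<in>UNIV. (if k = i then c * of_nat a * (p $ i) ^ (a - 1) * cnj (p $ i) ^ b else 0) * h $ k
      + (if k = i then c * of_nat b * (p $ i) ^ a * cnj (p $ i) ^ (b - 1) else 0) * cnj (h $ k))) (at p)"
proof -
  have *: "((\<lambda>q. q $ i) has_derivative (\<lambda>h. h $ i)) (at p)"
    by (rule bounded_linear.has_derivative[OF bounded_linear_vec_nth has_derivative_ident])
  have **: "((\<lambda>q. cnj (q $ i)) has_derivative (\<lambda>h. cnj (h $ i))) (at p)"
    by (rule bounded_linear.has_derivative[OF bounded_linear_cnj *])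
  show ?thesis
    by (rule has_derivative_eq_rhs, (rule derivative_intros * ** )+)
       (subst sum.remove[of _ i], auto simp: fun_eq_iff algebra_simps)
qed

text \<open>The coefficients of del rho. The w-entry is m cnj(w) |w|^(2m-2), written so that it
  remains a monomial.\<close>

definition egg_grad :: "nat \<Rightarrow> complex ^ 2 \<Rightarrow> 2 \<Rightarrow> complex" where
  "egg_grad m p j = (if j = 1 then cnj (p $ 1) else of_nat m * (p $ 2) ^ (m - 1) * cnj (p $ 2) ^ m)"

lemma egg_rho_eq: "complex_of_real (egg_rho m q) =
    1 * (q $ 1) ^ 1 * cnj (q $ 1) ^ 1 + 1 * (q $ 2) ^ m * cnj (q $ 2) ^ m - 1"
proof -
  have "complex_of_real (cmod w ^ (2 * m)) = w ^ m * cnj w ^ m" for w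
    by (metis complex_norm_square of_real_power power_mult power_mult_distrib)
  then show ?thesis
    by (simp add: egg_rho_def complex_norm_square del: of_real_power)
qed

lemma has_derivative_egg_rho:
  "((\<lambda>q. complex_of_real (egg_rho m q)) has_derivative
    (\<lambda>h. \<Sum>k\<in>UNIV. egg_grad m p k * h $ k + cnj (egg_grad m p k) * cnj (h $ k))) (at p)"
  unfolding egg_rho_eq
  by (rule has_derivative_eq_rhs, (rule derivative_intros has_derivative_monomial)+)
     (auto simp: fun_eq_iff sum_2 egg_grad_def algebra_simps)

lemma wirt_egg_rho: "wirt j (\<lambda>q. complex_of_real (egg_rho m q)) p = egg_grad m p j"
  and wirt_bar_egg_rho: "wirt_bar j (\<lambda>q. complex_of_real (egg_rho m q)) p = cnj (egg_grad m p j)"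
  by (rule wirt_has_derivative[OF has_derivative_egg_rho])+

text \<open>The complex Hessian sees only the conjugate-linear part \<open>H\<close>; the
  complex-linear part \<open>D\<close> stays existential.\<close>

lemma has_derivative_egg_grad:
  fixes m :: nat and p :: "complex ^ 2"
  defines "H \<equiv> \<lambda>j. if j = (1::2) then 1 else (of_nat m)\<^sup>2 * of_real (cmod (p $ 2) ^ (2 * m - 2))"
  shows "\<exists>D. ((\<lambda>q. egg_grad m q j) has_derivative
    (\<lambda>h. \<Sum>k\<in>UNIV. D k * h $ k + (if k = j then H j else 0) * cnj (h $ k))) (at p)"
proof (cases "j = 1")
  case True
  show ?thesis
    unfolding True egg_grad_def
    by (rule exI[of _ "\<lambda>_. 0"], rule has_derivative_eq_rhs, simp,
        rule has_derivative_monomial[of 1 1 0 1 p, simplified])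
       (simp add: H_def fun_eq_iff sum_2)
next
  case False
  then have j: "j = 2" using exhaust_2 by blast
  have H: "H 2 = of_nat m * of_nat m * (p $ 2) ^ (m - 1) * cnj (p $ 2) ^ (m - 1)"
  proof -
    have "complex_of_real (cmod w ^ (2 * m - 2)) = w ^ (m-1) * cnj w ^ (m-1)" for w
      by (metis complex_norm_square of_real_power power_mult power_mult_distrib right_diff_distrib' mult_numeral_1_right numeral_One)
    then show ?thesis by (simp add: H_def power2_eq_square)
  qed
  show ?thesis
    unfolding j egg_grad_def
    by (rule exI[of _ "\<lambda>k. if k = 2 then of_nat m * of_nat (m - 1) * (p $ 2) ^ (m - 1 - 1) * cnj (p $ 2) ^ m else 0"],
        rule has_derivative_eq_rhs, simp,
        rule has_derivative_monomial[of "of_nat m" 2 "m - 1" m p, simplified])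
       (auto simp: H fun_eq_iff sum_2)
qed

text \<open>The entry of the complex Hessian in the w-direction. The Hessian is diagonal and its
  other entry is 1, so all degeneration sits here, at w = 0 when m > 1; for m = 1 the convention 0^0
  = 1 makes it constant.\<close>

definition egg_hess :: "nat \<Rightarrow> complex ^ 2 \<Rightarrow> real" where
  "egg_hess m p = (real m)\<^sup>2 * cmod (p $ 2) ^ (2 * m - 2)"

lemma wirt_bar_wirt_egg_rho:
  "wirt_bar k (wirt j (\<lambda>q. complex_of_real (egg_rho m q))) p =
    (if j = k then (if j = 1 then 1 else of_real (egg_hess m p)) else 0)"
proof -
  have "wirt j (\<lambda>q. complex_of_real (egg_rho m q)) = (\<lambda>q. egg_grad m q j)"
    by (rule ext) (rule wirt_egg_rho)
  with has_derivative_egg_grad[of m j p] show ?thesis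
    by (auto simp: egg_hess_def dest!: wirt_has_derivative(2)[where j=k])
qed

lemma wirt_wirt_bar_egg_rho:
  "wirt j (wirt_bar k (\<lambda>q. complex_of_real (egg_rho m q))) p =
    (if j = k then (if j = 1 then 1 else of_real (egg_hess m p)) else 0)"
proof -
  have eq: "wirt_bar k (\<lambda>q. complex_of_real (egg_rho m q)) = (\<lambda>q. cnj (egg_grad m q k))"
    by (rule ext) (rule wirt_bar_egg_rho)
  define H where "H = (\<lambda>k. if k = (1::2) then 1 else (of_nat m)\<^sup>2 * complex_of_real (cmod (p $ 2) ^ (2 * m - 2)))"
  obtain D where "((\<lambda>q. egg_grad m q k) has_derivative
    (\<lambda>h. \<Sum>i\<in>UNIV. D i * h $ i + (if i = k then H k else 0) * cnj (h $ i))) (at p)"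
    using has_derivative_egg_grad[of m k p] unfolding H_def by blast
  then have "((\<lambda>q. cnj (egg_grad m q k)) has_derivative
    (\<lambda>h. \<Sum>i\<in>UNIV. cnj (if i = k then H k else 0) * h $ i + cnj (D i) * cnj (h $ i))) (at p)"
    by (rule has_derivative_eq_rhs[OF bounded_linear.has_derivative[OF bounded_linear_cnj]])
       (auto simp: fun_eq_iff add_ac)
  from wirt_has_derivative(1)[OF this, of j] show ?thesis
    unfolding eq by (auto simp: H_def egg_hess_def)
qed

definition egg_boundary :: "nat \<Rightarrow> (complex ^ 2) set" where
  "egg_boundary m = {p. (cmod (p $ 1))\<^sup>2 + cmod (p $ 2) ^ (2 * m) = 1}"

text \<open>The splitting 4m - 2 = (2m - 2) + 2m exposes \<open>egg_hess\<close> as a common factor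
  of the bordered determinant and of the form; what remains is |z|^2 + |w|^(2m), which is 1 on the
  boundary.\<close>

lemma norm_egg_grad:
  assumes "m \<ge> 1"
  shows "(cmod (egg_grad m p 2))\<^sup>2 = egg_hess m p * cmod (p $ 2) ^ (2 * m)"
proof -
  have "m * 2 - 2 + m * 2 = (m - 1 + m) * 2" using assms by simp
  then show ?thesis
  by (simp add: egg_grad_def egg_hess_def norm_mult norm_power power_mult_distrib flip: power_add power_mult)
    (simp add: algebra_simps)
qed

lemma fefferman_weight_egg:
  assumes m: "m \<ge> 1" and p: "p \<in> egg_boundary m"
  shows "fefferman_weight (egg_rho m) p =
    (egg_hess m p) powr (1/3) / sqrt ((cmod (p $ 1))\<^sup>2 + egg_hess m p * cmod (p $ 2) ^ (2 * m))"
proof -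
  have rho: "egg_rho m p = 0" using p by (simp add: egg_rho_def egg_boundary_def)
  \<comment> \<open>The corner entry is rho = 0 and the Hessian is diagonal, so only two of the six
    products survive.\<close>
  have "det (bordered_hessian (egg_rho m) p) =
     - complex_of_real ((cmod (egg_grad m p 1))\<^sup>2 * egg_hess m p + (cmod (egg_grad m p 2))\<^sup>2)"
    unfolding det_option_2 bordered_hessian_def complex_norm_square of_real_add of_real_mult
    by (simp add: wirt_egg_rho wirt_bar_egg_rho wirt_wirt_bar_egg_rho rho algebra_simps)
  also have "\<dots> = - of_real (egg_hess m p * ((cmod (p $ 1))\<^sup>2 + cmod (p $ 2) ^ (2 * m)))"
    by (simp only: norm_egg_grad[OF m]) (simp add: egg_grad_def algebra_simps)
  also have "\<dots> = - of_real (egg_hess m p)"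
    using p by (simp add: egg_boundary_def)
  finally have "cmod (det (bordered_hessian (egg_rho m) p)) = egg_hess m p"
    by (simp add: egg_hess_def norm_mult norm_power)
  then show ?thesis
    unfolding fefferman_weight_def sum_2 wirt_egg_rho norm_egg_grad[OF m]
    by (simp add: egg_grad_def)
qed

section \<open>The boundary and the form on its tangent spaces\<close>

lemma egg_frontier:
  assumes m: "m \<ge> 1"
  shows "frontier (egg_domain m) = egg_boundary m"
proof -
  let ?f = "\<lambda>p :: complex ^ 2. (cmod (p $ 1))\<^sup>2 + cmod (p $ 2) ^ (2 * m)"
  have cont: "continuous_on UNIV ?f"
    by (intro continuous_intros)
  have "open (egg_domain m)"
    unfolding egg_domain_def using open_Collect_less[OF cont continuous_on_const] by simp
  moreover have "closure (egg_domain m) \<subseteq> {p. ?f p \<le> 1}"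
    by (rule closure_minimal) (auto simp: egg_domain_def intro!: closed_Collect_le cont)
  moreover have "p \<in> closure (egg_domain m)" if p: "?f p = 1" for p
  proof -
    \<comment> \<open>Radial shrinking by a factor t < 1: since t^(2m) <= t^2, the defining sum at t
      p is at most t^2 < 1, so \<open>p\<close> is a limit of interior points.\<close>
    define X where "X = (\<lambda>n. (1 - inverse (real (Suc n))) *\<^sub>R p)"
    have "X n \<in> egg_domain m" for n
    proof -
      let ?t = "1 - inverse (real (Suc n))"
      have t: "0 \<le> ?t" "?t < 1" by (auto simp: field_simps)
      then have "?t ^ 2 < 1" "?t ^ (2 * m) \<le> ?t ^ 2"
        using m by (auto intro!: power_decreasing simp: power_less_one_iff abs_square_less_1)
      have "?f (X n) = ?t ^ 2 * (cmod (p $ 1))\<^sup>2 + ?t ^ (2 * m) * cmod (p $ 2) ^ (2 * m)"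
        using t by (simp add: X_def power_mult_distrib abs_of_nonneg)
      also have "\<dots> \<le> ?t ^ 2 * (cmod (p $ 1))\<^sup>2 + ?t ^ 2 * cmod (p $ 2) ^ (2 * m)"
        using \<open>?t ^ (2 * m) \<le> ?t ^ 2\<close> by (intro add_mono mult_right_mono) auto
      also have "\<dots> = ?t ^ 2 * ?f p" by (simp add: distrib_left)
      also have "\<dots> < 1" using \<open>?t ^ 2 < 1\<close> p by simp
      finally show ?thesis by (simp add: egg_domain_def)
    qed
    moreover have "X \<longlonglongrightarrow> (1 - 0) *\<^sub>R p"
      unfolding X_def by (intro tendsto_intros LIMSEQ_inverse_real_of_nat)
    ultimately show ?thesis
      unfolding closure_sequential by auto
  qed
  ultimately show ?thesis
    unfolding frontier_def egg_boundary_def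
    by (auto simp: interior_open egg_domain_def subset_eq)
qed

section \<open>The coordinates (w, arg z) and the form on tangent vectors\<close>

definition egg_coord :: "complex ^ 2 \<Rightarrow> real ^ 3" where
  "egg_coord p = vector [Re (p $ 2), Im (p $ 2), Arg (p $ 1)]"

text \<open>The third entry is the differential of the angle, d arg z = Im (dz / z). It makes sense
  for all nonzero z, even on the negative axis, where \<open>egg_coord\<close> jumps.\<close>

definition egg_coord_deriv :: "complex ^ 2 \<Rightarrow> complex ^ 2 \<Rightarrow> real ^ 3" where
  "egg_coord_deriv p h = vector [Re (h $ 2), Im (h $ 2), Im (h $ 1 / p $ 1)]"

lemma has_derivative_egg_coord:
  assumes "p $ 1 \<notin> \<real>\<^sub>\<le>\<^sub>0"
  shows "(egg_coord has_derivative egg_coord_deriv p) (at p)"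
proof -
  have *: "((\<lambda>q. q $ i) has_derivative (\<lambda>h. h $ i)) (at p)" for i
    by (rule bounded_linear.has_derivative[OF bounded_linear_vec_nth has_derivative_ident])
  have "(Ln has_derivative (\<lambda>h. inverse (p $ 1) * h)) (at (p $ 1))"
    using has_field_derivative_Ln[OF assms] by (simp add: has_field_derivative_def)
  from bounded_linear.has_derivative[OF bounded_linear_Im has_derivative_compose[OF *[of 1] this]]
  have "((\<lambda>q. Im (Ln (q $ 1))) has_derivative (\<lambda>h. Im (inverse (p $ 1) * h $ 1))) (at p)" .
  then have "((\<lambda>q. Arg (q $ 1)) has_derivative (\<lambda>h. Im (inverse (p $ 1) * h $ 1))) (at p)"
  proof (rule has_derivative_transform_within_open[where s="{q. q $ 1 \<noteq> 0}"])
    show "open {q :: complex ^ 2. q $ 1 \<noteq> 0}"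
      by (intro open_Collect_neq continuous_intros)
    show "p \<in> {q. q $ 1 \<noteq> 0}" using assms by auto
  qed (auto simp: Arg_eq_Im_Ln)
  then have arg: "((\<lambda>q. Arg (q $ 1)) has_derivative (\<lambda>h. Im (h $ 1 / p $ 1))) (at p)"
    by (simp add: divide_inverse mult.commute)
  have "((\<lambda>q. egg_coord q $ i) has_derivative (\<lambda>h. egg_coord_deriv p h $ i)) (at p)" for i
    using exhaust_3[of i] unfolding egg_coord_def egg_coord_deriv_def
    by (auto intro!: arg bounded_linear.has_derivative[OF bounded_linear_Re *]
        bounded_linear.has_derivative[OF bounded_linear_Im *])
  then show ?thesis
    by (subst has_derivative_componentwise_within)
       (auto simp: Basis_vec_def inner_axis)
qed

text \<open>In wedge notation this is (Z c + Q) wedge (c wedge P + H x wedge y). The terms with a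
  repeated c vanish, and so does Q wedge x wedge y since Q combines x and y. From P wedge Q = (p^2 +
  q^2) x wedge y there remains (Z H + p^2 + q^2) c wedge x wedge y, and Z H + H W = H.\<close>

lemma real_alternating_identity:
  fixes Z H W p q :: real
  assumes "p\<^sup>2 + q\<^sup>2 = H * W" "Z + W = 1"
  defines "P \<equiv> \<lambda>x y. p * x - q * y" and "Q \<equiv> \<lambda>x y. p * y + q * x"
  shows "(Z * c1 + Q x1 y1) * (c2 * P x3 y3 - c3 * P x2 y2 + H * (x2 * y3 - y2 * x3))
    - (Z * c2 + Q x2 y2) * (c1 * P x3 y3 - c3 * P x1 y1 + H * (x1 * y3 - y1 * x3))
    + (Z * c3 + Q x3 y3) * (c1 * P x2 y2 - c2 * P x1 y1 + H * (x1 * y2 - y1 * x2))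
    = H * (x1 * y2 * c3 + x2 * y3 * c1 + x3 * y1 * c2 - x1 * y3 * c2 - x2 * y1 * c3 - x3 * y2 * c1)"
proof -
  have "H = Z * H + (p\<^sup>2 + q\<^sup>2)"
    unfolding assms(1) using assms(2) by (metis distrib_left mult.commute mult_1)
  then show ?thesis
    unfolding P_def Q_def by algebra
qed

text \<open>For real rho, tangency means Re (del rho)(v) = 0, which fixes Re (cnj(z) dz) through dw,
  while the angular speed \<open>c\<close> fixes the imaginary part. Hence dw and d arg z determine
  dz.\<close>

lemma tangent_fst:
  assumes "p $ 1 \<noteq> 0" and "Re (\<Sum>k\<in>UNIV. egg_grad m p k * v $ k) = 0"
  defines "c \<equiv> Im (v $ 1 / p $ 1)" and "Gb \<equiv> egg_grad m p 2 * v $ 2"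
  shows "cnj (p $ 1) * v $ 1 = Complex (- Re Gb) ((cmod (p $ 1))\<^sup>2 * c)"
    and "v $ 1 = p $ 1 * Complex (- Re Gb / (cmod (p $ 1))\<^sup>2) c"
proof -
  have Z: "(cmod (p $ 1))\<^sup>2 \<noteq> 0" using assms by simp
  show *: "cnj (p $ 1) * v $ 1 = Complex (- Re Gb) ((cmod (p $ 1))\<^sup>2 * c)"
  proof (rule complex_eqI)
    show "Re (cnj (p $ 1) * v $ 1) = Re (Complex (- Re Gb) ((cmod (p $ 1))\<^sup>2 * c))"
      using assms(2) by (simp add: sum_2 egg_grad_def Gb_def)
    have "cnj (p $ 1) * v $ 1 = (cmod (p $ 1))\<^sup>2 * (v $ 1 / p $ 1)"
      using assms(1) by (simp add: complex_norm_square del: of_real_power)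
    also have "Im \<dots> = Im (Complex (- Re Gb) ((cmod (p $ 1))\<^sup>2 * c))"
      unfolding c_def by (simp only: times_complex.sel Re_complex_of_real Im_complex_of_real mult_zero_left add_0_right complex.sel)
    finally show "Im (cnj (p $ 1) * v $ 1) = Im (Complex (- Re Gb) ((cmod (p $ 1))\<^sup>2 * c))" .
  qed
  have "(cmod (p $ 1))\<^sup>2 * v $ 1 = p $ 1 * (cnj (p $ 1) * v $ 1)"
    by (simp add: complex_norm_square del: of_real_power)
  also have "\<dots> = (cmod (p $ 1))\<^sup>2 * (p $ 1 * Complex (- Re Gb / (cmod (p $ 1))\<^sup>2) c)"
    unfolding * using Z by (simp add: complex_eq_iff field_simps del: of_real_power)
  finally show "v $ 1 = p $ 1 * Complex (- Re Gb / (cmod (p $ 1))\<^sup>2) c"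
    using Z by simp
qed

text \<open>Once dz is eliminated, del rho is i times a real form and delbar del rho is 2 i times a
  real form. The factor i * 2 i = -2, divided by (2 pi i)^2 = -4 pi^2, gives the constant 1 / (2
  pi^2).\<close>

lemma leray_levi_egg_tangent:
  assumes m: "m \<ge> 1" and p: "p \<in> egg_boundary m" "p $ 1 \<noteq> 0"
    and t: "\<And>i. Re (\<Sum>k\<in>UNIV. egg_grad m p k * v i $ k) = 0"
  shows "cmod (leray_levi_form (egg_rho m) p (v 1) (v 2) (v (3::3))) =
    egg_hess m p / (2 * pi\<^sup>2) * \<bar>det (\<chi> i j. egg_coord_deriv p (v j) $ i)\<bar>"
proof -
  define c where "c i = Im (v i $ 1 / p $ 1)" for i
  define x where "x i = Re (v i $ 2)" for i
  define y where "y i = Im (v i $ 2)" for i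
  define G where "G = egg_grad m p 2"
  define P where "P i = Re G * x i - Im G * y i" for i
  define Q where "Q i = Re G * y i + Im G * x i" for i
  define Z where "Z = (cmod (p $ 1))\<^sup>2"
  define W where "W = cmod (p $ 2) ^ (2 * m)"
  define H where "H = egg_hess m p"
  have Z0: "Z \<noteq> 0" using p by (simp add: Z_def)
  have Gb: "G * v i $ 2 = Complex (P i) (Q i)" for i
    by (simp add: complex_eq_iff P_def Q_def x_def y_def)
  have a1: "cnj (p $ 1) * v i $ 1 = Complex (- P i) (Z * c i)" for i
    using tangent_fst(1)[OF p(2) t[of i]] by (simp add: Gb flip: G_def c_def Z_def)
  have a2: "v i $ 1 = p $ 1 * Complex (- P i / Z) (c i)" for i
    using tangent_fst(2)[OF p(2) t[of i]] by (simp add: Gb flip: G_def c_def Z_def)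
  have del: "del_form (egg_rho m) p (v i) = \<i> * of_real (Z * c i + Q i)" for i
    unfolding del_form_def wirt_egg_rho sum_2
    by (simp add: Gb a1[unfolded complex_eq_iff] egg_grad_def[of _ _ 1] complex_eq_iff flip: G_def)
       (use a1[of i, unfolded complex_eq_iff] in simp)
  have aa: "cnj (v i $ 1) * v j $ 1 = Z * (cnj (Complex (- P i / Z) (c i)) * Complex (- P j / Z) (c j))" for i j
    unfolding a2 Z_def complex_norm_square by simp
  have ddel: "delbar_del_form (egg_rho m) p (v i) (v j) =
      2 * \<i> * of_real (c i * P j - c j * P i + H * (x i * y j - y i * x j))" for i j
    unfolding delbar_del_form_def wirt_bar_wirt_egg_rho sum_2
    using Z0
    by (simp add: aa right_diff_distrib) (simp add: complex_eq_iff field_simps flip: x_def y_def H_def)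
  have "wedge12 (del_form (egg_rho m)) (delbar_del_form (egg_rho m)) p (v 1) (v 2) (v 3) =
     - 2 * of_real ((Z * c 1 + Q 1) * (c 2 * P 3 - c 3 * P 2 + H * (x 2 * y 3 - y 2 * x 3))
    - (Z * c 2 + Q 2) * (c 1 * P 3 - c 3 * P 1 + H * (x 1 * y 3 - y 1 * x 3))
    + (Z * c 3 + Q 3) * (c 1 * P 2 - c 2 * P 1 + H * (x 1 * y 2 - y 1 * x 2)))"
    unfolding wedge12_def del ddel by (simp add: algebra_simps)
  also have "\<dots> = - 2 * of_real (H * (x 1 * y 2 * c 3 + x 2 * y 3 * c 1 + x 3 * y 1 * c 2 - x 1 * y 3 * c 2 - x 2 * y 1 * c 3 - x 3 * y 2 * c 1))"
  proof -
    have "(Re G)\<^sup>2 + (Im G)\<^sup>2 = H * W"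
      using norm_egg_grad[OF m, of p] by (simp add: G_def H_def W_def cmod_power2)
    moreover have "Z + W = 1" using p by (simp add: Z_def W_def egg_boundary_def)
    ultimately show ?thesis
      unfolding P_def Q_def
      by (subst real_alternating_identity[where p="Re G" and q="Im G" and W=W]) (rule refl | assumption)+
  qed
  also have "x 1 * y 2 * c 3 + x 2 * y 3 * c 1 + x 3 * y 1 * c 2 - x 1 * y 3 * c 2 - x 2 * y 1 * c 3 - x 3 * y 2 * c 1
     = det (\<chi> i j. egg_coord_deriv p (v j) $ i)"
    by (simp add: det_3 egg_coord_deriv_def x_def y_def c_def)
  finally have "cmod (wedge12 (del_form (egg_rho m)) (delbar_del_form (egg_rho m)) p (v 1) (v 2) (v 3)) =
    2 * (H * \<bar>det (\<chi> i j. egg_coord_deriv p (v j) $ i)\<bar>)"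
    by (simp add: norm_mult H_def egg_hess_def abs_mult del: of_real_mult)
  then show ?thesis
    unfolding leray_levi_form_def
    by (simp add: norm_divide norm_mult norm_power power_mult_distrib H_def)
qed

section \<open>Change of variables for local parametrisations\<close>

text \<open>Formulated for a measurable \<open>S\<close> and derivatives within \<open>S\<close>,
  since it is applied to the part of a chart domain lying over a Borel set.\<close>

lemma nn_integral_change_of_variables:
  fixes g :: "real^'n::{finite,wellorder} \<Rightarrow> real^'n::_" and f :: "real^'n::_ \<Rightarrow> real"
  assumes S: "S \<in> sets lebesgue"
    and der: "\<And>x. x \<in> S \<Longrightarrow> (g has_derivative g' x) (at x within S)"
    and inj: "inj_on g S"
    and f: "f absolutely_integrable_on g ` S" and nonneg: "\<And>y. y \<in> g ` S \<Longrightarrow> 0 \<le> f y"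
  shows "(\<integral>\<^sup>+y\<in>g ` S. ennreal (f y) \<partial>lborel) =
    (\<integral>\<^sup>+x\<in>S. ennreal (\<bar>det (matrix (g' x))\<bar> * f (g x)) \<partial>lborel)"
proof -
  \<comment> \<open>The change of variables theorem is for vector-valued integrands, so the scalar
    function is carried by a vector with one component.\<close>
  define F :: "real^'n::_ \<Rightarrow> real^1" where "F = (\<lambda>y. vec (f y))"
  have "F absolutely_integrable_on g ` S"
    using f by (simp add: F_def absolutely_integrable_on_1_iff)
  then have "(\<lambda>x. \<bar>det (matrix (g' x))\<bar> *\<^sub>R F (g x)) absolutely_integrable_on S \<and>
      integral S (\<lambda>x. \<bar>det (matrix (g' x))\<bar> *\<^sub>R F (g x)) = integral (g ` S) F"
    using has_absolute_integral_change_of_variables[OF S der inj] by blast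
  then have *: "(\<lambda>x. \<bar>det (matrix (g' x))\<bar> * f (g x)) absolutely_integrable_on S"
      "integral S (\<lambda>x. \<bar>det (matrix (g' x))\<bar> * f (g x)) = integral (g ` S) f"
    by (auto simp: F_def absolutely_integrable_on_1_iff integral_on_1_eq vec_eq_iff)
  show ?thesis
    using nn_integral_has_integral_lebesgue'[of "g ` S" f]
      nn_integral_has_integral_lebesgue'[of S "\<lambda>x. \<bar>det (matrix (g' x))\<bar> * f (g x)"]
      nonneg set_lebesgue_integral_eq_integral(1)[OF f] set_lebesgue_integral_eq_integral(1)[OF *(1)] *(2)
    by (simp add: has_integral_integral)
qed

text \<open>An open set is a countable union of compact boxes, so its continuous image is a
  countable union of compact sets.\<close>

lemma borel_continuous_image_open:
  fixes f :: "'a::euclidean_space \<Rightarrow> 'b::t2_space"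
  assumes "open U" "continuous_on U f"
  shows "f ` U \<in> sets borel"
proof -
  obtain \<D> where \<D>: "countable \<D>" "\<D> \<subseteq> Pow U" "\<And>X. X \<in> \<D> \<Longrightarrow> \<exists>a b. X = cbox a b" "\<Union>\<D> = U"
    using open_countable_Union_open_cbox[OF assms(1)] by metis
  have "compact (f ` X)" if "X \<in> \<D>" for X
    using \<D>(2,4) \<D>(3)[OF that] that
    by (intro compact_continuous_image continuous_on_subset[OF assms(2)]) auto
  then have "(\<Union>X\<in>\<D>. f ` X) \<in> sets borel"
    using \<D>(1) by (intro sets.countable_UN') (auto intro!: borel_compact)
  then show ?thesis
    unfolding \<D>(4)[symmetric] by (simp add: image_Union)
qed

text \<open>Replacing the coordinate along \<open>e\<close> by \<open>h\<close> is a locally invertible change of coordinates that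
  maps the zero set of \<open>h\<close> into a hyperplane.\<close>

lemma negligible_regular_zero_set:
  fixes h :: "'a::euclidean_space \<Rightarrow> real"
  assumes der: "\<And>x. x \<in> U \<Longrightarrow> (h has_derivative h' x) (at x)" and e: "e \<in> Basis"
  shows "negligible {x \<in> U. h x = 0 \<and> h' x e \<noteq> 0}"
proof -
  define S where "S = {x \<in> U. h' x e \<noteq> 0}"
  define g where "g x = x + (h x - x \<bullet> e) *\<^sub>R e" for x
  have "negligible {x \<in> S. g x \<in> {y. y \<bullet> e = 0}}"
  proof (rule negligible_differentiable_vimage)
    show "negligible {y :: 'a. y \<bullet> e = 0}"
      by (rule negligible_standard_hyperplane[OF e])
    fix x assume x: "x \<in> S"
    then have der: "(h has_derivative h' x) (at x)" and nz: "h' x e \<noteq> 0"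
      using der by (auto simp: S_def)
    have lin: "linear (h' x)" using der by (rule has_derivative_linear)
    show "(g has_derivative (\<lambda>v. v + (h' x v - v \<bullet> e) *\<^sub>R e)) (at x within S)"
      unfolding g_def
      by (rule has_derivative_at_withinI) (auto intro!: derivative_eq_intros der)
    have "linear (\<lambda>v. v + (h' x v - v \<bullet> e) *\<^sub>R e)"
      by (rule linearI)
         (auto simp: algebra_simps linear_add[OF lin] linear_scale[OF lin])
    moreover have "v = 0" if eq: "v + (h' x v - v \<bullet> e) *\<^sub>R e = 0" for v
    proof -
      have v: "v = (v \<bullet> e - h' x v) *\<^sub>R e" using eq by (simp add: algebra_simps add_eq_0_iff)
      moreover have "h' x v = 0"
        using arg_cong[OF eq, of "\<lambda>w. w \<bullet> e"] e by (simp add: algebra_simps)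
      ultimately have "v = (v \<bullet> e) *\<^sub>R e" by simp
      then have "h' x v = (v \<bullet> e) * h' x e" by (metis lin linear_scale real_scaleR_def)
      with \<open>h' x v = 0\<close> nz have "v \<bullet> e = 0" by simp
      with \<open>v = (v \<bullet> e) *\<^sub>R e\<close> show ?thesis by simp
    qed
    ultimately show "inj (\<lambda>v. v + (h' x v - v \<bullet> e) *\<^sub>R e)"
      using linear_injective_0 by blast
  qed
  then show ?thesis
    by (rule negligible_subset) (use e in \<open>auto simp: S_def g_def inner_add_left\<close>)
qed

lemma local_param3_has_derivative:
  assumes "local_param3 M U \<phi>" "u \<in> U"
  shows "(\<phi> has_derivative frechet_derivative \<phi> (at u)) (at u)"
  using assms by (auto simp: local_param3_def frechet_derivative_works)

lemma local_param3_continuous_on: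
  assumes "local_param3 M U \<phi>"
  shows "continuous_on U \<phi>"
  by (rule continuous_at_imp_continuous_on)
     (use local_param3_has_derivative[OF assms] has_derivative_continuous in blast)

lemma egg_tangent:
  assumes par: "local_param3 (egg_boundary m) U \<phi>" and u: "u \<in> U"
  shows "Re (\<Sum>k\<in>UNIV. egg_grad m (\<phi> u) k * frechet_derivative \<phi> (at u) h $ k) = 0"
proof -
  let ?F = "frechet_derivative \<phi> (at u)"
  have U: "open U" and M: "\<phi> ` U \<subseteq> egg_boundary m"
    using par by (auto simp: local_param3_def)
  have d1: "((\<lambda>u. complex_of_real (egg_rho m (\<phi> u))) has_derivative
    (\<lambda>h. \<Sum>k\<in>UNIV. egg_grad m (\<phi> u) k * ?F h $ k + cnj (egg_grad m (\<phi> u) k) * cnj (?F h $ k))) (at u)"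
    by (rule has_derivative_compose[OF local_param3_has_derivative[OF par u] has_derivative_egg_rho])
  have d2: "((\<lambda>u. complex_of_real (egg_rho m (\<phi> u))) has_derivative (\<lambda>h. 0)) (at u)"
    by (rule has_derivative_transform_within_open[where f="\<lambda>_. 0", OF _ U u])
       (use M in \<open>auto simp: egg_rho_def egg_boundary_def simp del: of_real_add of_real_power\<close>)
  have "(\<Sum>k\<in>UNIV. egg_grad m (\<phi> u) k * ?F h $ k + cnj (egg_grad m (\<phi> u) k) * cnj (?F h $ k)) = 0"
    by (rule fun_cong[OF has_derivative_unique[OF d1 d2]])
  then have "Re (\<Sum>k\<in>UNIV. egg_grad m (\<phi> u) k * ?F h $ k + cnj (egg_grad m (\<phi> u) k) * cnj (?F h $ k)) = 0"
    by simp
  then show ?thesis by (simp add: sum_2)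
qed

text \<open>Where \<open>z\<close> is real, \<open>Im z\<close> has nonzero differential on the hypersurface: otherwise
  \<open>(Re z, Re w, Im w)\<close> would be surjective on the tangent space, which does not contain the complex
  gradient.\<close>

lemma negligible_Im_fst:
  assumes m: "m \<ge> 1" and par: "local_param3 (egg_boundary m) U \<phi>"
  shows "negligible {u \<in> U. Im (\<phi> u $ 1) = 0}"
proof -
  let ?F = "\<lambda>u. frechet_derivative \<phi> (at u)"
  let ?h' = "\<lambda>u v. Im (?F u v $ 1)"
  have der: "((\<lambda>u. Im (\<phi> u $ 1)) has_derivative ?h' u) (at u)" if "u \<in> U" for u
    by (rule bounded_linear.has_derivative[OF bounded_linear_Im]
        bounded_linear.has_derivative[OF bounded_linear_vec_nth]
        local_param3_has_derivative[OF par that])+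
  have "\<exists>e\<in>Basis. ?h' u e \<noteq> 0" if u: "u \<in> U" and z: "Im (\<phi> u $ 1) = 0" for u
  proof (rule ccontr)
    assume *: "\<not> ?thesis"
    have linh: "linear (?h' u)" by (rule has_derivative_linear[OF der[OF u]])
    have "?h' u = (\<lambda>_. 0)"
    proof (rule linear_eq_stdbasis[OF linh])
      show "linear (\<lambda>_ :: real^3. 0 :: real)" by (simp add: linear_iff)
    qed (use * in auto)
    then have Im0: "Im (?F u v $ 1) = 0" for v by (simp add: fun_eq_iff)
    define L :: "real^3 \<Rightarrow> real^3" where
      "L v = vector [Re (?F u v $ 1), Re (?F u v $ 2), Im (?F u v $ 2)]" for v
    have lin: "linear (?F u)"
      by (rule has_derivative_linear[OF local_param3_has_derivative[OF par u]])
    have "linear L"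
      by (rule linearI)
         (auto simp: L_def vec_eq_iff forall_3 linear_add[OF lin] linear_scale[OF lin])
    moreover have "inj L"
    proof (rule injI)
      fix v w assume "L v = L w"
      then have "?F u v = ?F u w"
        by (auto simp: L_def vec_eq_iff forall_3 forall_2 complex_eq_iff Im0)
      then show "v = w" using par u by (auto simp: local_param3_def inj_def)
    qed
    ultimately have "surj L" using linear_injective_imp_surjective by blast
    define G where "G = egg_grad m (\<phi> u) 2"
    \<comment> \<open>Because z is real and Im dz vanishes, this \<open>v\<close> has dz = z and dw
      = cnj G. On it Re (del rho) equals |z|^2 + |G|^2, so tangency forces z = 0 and G = 0, hence w
      = 0, off the boundary.\<close>
    obtain v where v: "L v = vector [Re (\<phi> u $ 1), Re G, - Im G]"
      using \<open>surj L\<close> by (metis surjD)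
    then have "Re (?F u v $ 1) = Re (\<phi> u $ 1)" "Re (?F u v $ 2) = Re G" "Im (?F u v $ 2) = - Im G"
      by (auto simp: L_def vec_eq_iff forall_3)
    then have "(Re (\<phi> u $ 1))\<^sup>2 + (Re G)\<^sup>2 + (Im G)\<^sup>2 = 0"
      using egg_tangent[OF par u, of v] z
      by (simp add: sum_2 egg_grad_def[of _ _ 1] power2_eq_square flip: G_def)
    then have "Re (\<phi> u $ 1) = 0 \<and> Re G = 0 \<and> Im G = 0"
      by (simp add: add_nonneg_eq_0_iff)
    then have "\<phi> u $ 1 = 0" "G = 0"
      using z by (auto simp: complex_eq_iff)
    moreover have "\<phi> u \<in> egg_boundary m" using par u by (auto simp: local_param3_def)
    ultimately show False
      using m by (auto simp: egg_boundary_def G_def egg_grad_def power_0_left)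
  qed
  then have "{u \<in> U. Im (\<phi> u $ 1) = 0} \<subseteq> (\<Union>e\<in>Basis. {u \<in> U. Im (\<phi> u $ 1) = 0 \<and> ?h' u e \<noteq> 0})"
    by auto
  moreover have "negligible (\<Union>e\<in>Basis. {u \<in> U. Im (\<phi> u $ 1) = 0 \<and> ?h' u e \<noteq> 0})"
    by (intro negligible_Union) (auto intro!: negligible_regular_zero_set der)
  ultimately show ?thesis by (rule negligible_subset[rotated])
qed

section \<open>A model of the boundary measure\<close>

definition egg_radius :: "nat \<Rightarrow> real ^ 3 \<Rightarrow> real" where
  "egg_radius m u = sqrt (1 - cmod (Complex (u $ 1) (u $ 2)) ^ (2 * m))"

definition egg_param :: "nat \<Rightarrow> real ^ 3 \<Rightarrow> complex ^ 2" where
  "egg_param m u = vector [of_real (egg_radius m u) * cis (u $ 3), Complex (u $ 1) (u $ 2)]"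

text \<open>The strict inequalities exclude z = 0 (that is, |w| = 1) and the negative reals, where
  \<open>Arg\<close> is pi.\<close>

definition egg_box :: "(real ^ 3) set" where
  "egg_box = {u. cmod (Complex (u $ 1) (u $ 2)) < 1 \<and> - pi < u $ 3 \<and> u $ 3 < pi}"

text \<open>The factor \<open>egg_hess\<close> / (2 pi^2) from
  \<open>leray_levi_egg_tangent\<close>, written in the coordinates.\<close>

definition egg_density :: "nat \<Rightarrow> real ^ 3 \<Rightarrow> real" where
  "egg_density m u = (real m)\<^sup>2 * cmod (Complex (u $ 1) (u $ 2)) ^ (2 * m - 2) / (2 * pi\<^sup>2)"

lemma continuous_on_Complex [continuous_intros]:
  "continuous_on S f \<Longrightarrow> continuous_on S g \<Longrightarrow> continuous_on S (\<lambda>x. Complex (f x) (g x))"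
  unfolding Complex_eq by (intro continuous_intros)

lemma continuous_on_egg_param: "continuous_on S (egg_param m)"
proof -
  have "continuous_on S (\<lambda>u. egg_param m u $ i)" for i
  proof -
    have "continuous_on S (\<lambda>u. egg_param m u $ 1)" "continuous_on S (\<lambda>u. egg_param m u $ 2)"
      by (simp_all add: egg_param_def egg_radius_def cis_conv_exp) (intro continuous_intros)+
    then show ?thesis using exhaust_2[of i] by metis
  qed
  then have "continuous_on S (\<lambda>u. \<chi> i. egg_param m u $ i)"
    by (intro continuous_on_vec_lambda)
  then show ?thesis by simp
qed

lemma continuous_on_egg_density: "continuous_on S (egg_density m)"
  unfolding egg_density_def by (intro continuous_intros) auto

lemma borel_measurable_egg_param [measurable]: "egg_param m \<in> borel \<rightarrow>\<^sub>M borel"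
  by (intro borel_measurable_continuous_onI continuous_on_egg_param)

lemma borel_measurable_egg_density [measurable]: "egg_density m \<in> borel \<rightarrow>\<^sub>M borel"
  by (intro borel_measurable_continuous_onI continuous_on_egg_density)

lemma open_egg_box: "open egg_box"
  unfolding egg_box_def by (intro open_Collect_conj open_Collect_less continuous_intros)

lemma borel_egg_box [measurable]: "egg_box \<in> sets borel"
  using open_egg_box by simp

lemma closed_egg_boundary: "closed (egg_boundary m)"
  unfolding egg_boundary_def by (intro closed_Collect_eq continuous_intros)

lemma egg_param_in_boundary:
  assumes "m \<ge> 1" "u \<in> egg_box"
  shows "egg_param m u \<in> egg_boundary m"
proof -
  have "cmod (Complex (u $ 1) (u $ 2)) ^ (2 * m) \<le> 1"
    using assms by (intro power_le_one) (auto simp: egg_box_def)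
  then show ?thesis
    by (simp add: egg_boundary_def egg_param_def egg_radius_def norm_mult)
qed

lemma egg_coord_param:
  assumes "m \<ge> 1" "u \<in> egg_box"
  shows "egg_coord (egg_param m u) = u" and "egg_param m u $ 1 \<notin> \<real>\<^sub>\<le>\<^sub>0"
proof -
  have "cmod (Complex (u $ 1) (u $ 2)) ^ (2 * m) < 1"
    using assms by (simp add: egg_box_def power_less_one_iff del: power_mult)
  then have r: "egg_radius m u > 0" by (simp add: egg_radius_def)
  then have arg: "Arg (egg_param m u $ 1) = u $ 3"
    using assms by (intro Arg_unique[where r="egg_radius m u"])
      (auto simp: egg_param_def cis_conv_exp egg_box_def)
  then show "egg_coord (egg_param m u) = u"
    by (simp add: egg_coord_def vec_eq_iff forall_3 egg_param_def)
  show "egg_param m u $ 1 \<notin> \<real>\<^sub>\<le>\<^sub>0"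
  proof
    assume *: "egg_param m u $ 1 \<in> \<real>\<^sub>\<le>\<^sub>0"
    moreover have "egg_param m u $ 1 \<noteq> 0" using r by (simp add: egg_param_def)
    ultimately have "Arg (egg_param m u $ 1) = pi"
      by (auto simp: Arg_eq_pi complex_nonpos_Reals_iff complex_eq_iff)
    then show False using arg assms by (simp add: egg_box_def)
  qed
qed

text \<open>Valid on the whole boundary: on the cut \<open>Arg\<close> still is an angle of z, and
  at z = 0 the radius is 0, so that any angle will do. Thus \<open>egg_coord\<close> is injective on
  the boundary.\<close>

lemma egg_param_coord:
  assumes p: "p \<in> egg_boundary m"
  shows "egg_param m (egg_coord p) = p"
proof -
  have "egg_radius m (egg_coord p) = sqrt ((cmod (p $ 1))\<^sup>2)"
    unfolding egg_radius_def using p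
    by (intro arg_cong[of _ _ sqrt]) (simp add: egg_coord_def egg_boundary_def)
  then have r: "egg_radius m (egg_coord p) = cmod (p $ 1)" by simp
  have "p $ 1 = of_real (cmod (p $ 1)) * cis (Arg (p $ 1))"
    by (cases "p $ 1 = 0") (simp_all add: Arg_eq cis_conv_exp)
  then show ?thesis
    by (simp add: egg_param_def r vec_eq_iff forall_2) (simp add: egg_coord_def)
qed

lemma egg_coord_in_box:
  assumes "m \<ge> 1" "p \<in> egg_boundary m" "p $ 1 \<notin> \<real>\<^sub>\<le>\<^sub>0"
  shows "egg_coord p \<in> egg_box"
proof -
  have "cmod (p $ 2) ^ (2 * m) < 1"
    using assms by (auto simp: egg_boundary_def) (metis add.commute less_add_same_cancel1 nonpos_Reals_zero_I zero_less_norm_iff zero_less_power)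
  then have "cmod (p $ 2) < 1"
    using one_le_power[of "cmod (p $ 2)" "2 * m"] by linarith
  moreover have "Arg (p $ 1) < pi"
    using assms Arg_le_pi[of "p $ 1"] Arg_eq_pi[of "p $ 1"] by (auto simp: complex_nonpos_Reals_iff less_le)
  ultimately show ?thesis
    using mpi_less_Arg[of "p $ 1"] by (simp add: egg_box_def egg_coord_def)
qed

text \<open>The candidate for \<open>egg_S\<close>: one chart carries the whole mass.\<close>

definition egg_model :: "nat \<Rightarrow> (complex ^ 2) measure" where
  "egg_model m = restrict_space
    (distr (density lborel (\<lambda>u. ennreal (egg_density m u) * indicator egg_box u)) borel (egg_param m))
    (egg_boundary m)"

lemma sets_egg_model: "sets (egg_model m) = sets (restrict_space borel (egg_boundary m))"
  by (simp add: egg_model_def sets_restrict_space)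

lemma space_egg_model: "space (egg_model m) = egg_boundary m"
  by (simp add: egg_model_def space_restrict_space)

lemma nn_integral_egg_model:
  assumes m: "m \<ge> 1" and f [measurable]: "f \<in> borel_measurable (egg_model m)"
  shows "(\<integral>\<^sup>+p. f p \<partial>egg_model m) =
    (\<integral>\<^sup>+u\<in>egg_box. f (egg_param m u) * ennreal (egg_density m u) \<partial>lborel)"
proof -
  have M [measurable]: "egg_boundary m \<in> sets borel"
    using closed_egg_boundary by simp
  have "f \<in> borel_measurable (restrict_space borel (egg_boundary m))"
    using f by (simp cong: measurable_cong_sets add: sets_egg_model)
  then have f' [measurable]: "(\<lambda>p. f p * indicator (egg_boundary m) p) \<in> borel_measurable borel"
    by (subst (asm) borel_measurable_restrict_space_iff_ennreal) auto
  have "(\<integral>\<^sup>+p. f p \<partial>egg_model m) = (\<integral>\<^sup>+u. ennreal (egg_density m u) * indicator egg_box u *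
      (f (egg_param m u) * indicator (egg_boundary m) (egg_param m u)) \<partial>lborel)"
    unfolding egg_model_def
    using measurable_compose[OF borel_measurable_egg_param f'] borel_egg_box
    by (subst nn_integral_restrict_space, simp, subst nn_integral_distr, measurable,
        subst nn_integral_density) auto
  also have "\<dots> = (\<integral>\<^sup>+u\<in>egg_box. f (egg_param m u) * ennreal (egg_density m u) \<partial>lborel)"
    by (intro nn_integral_cong) (auto simp: indicator_def egg_param_in_boundary[OF m] mult_ac)
  finally show ?thesis .
qed

lemma emeasure_egg_model:
  assumes m: "m \<ge> 1" and A: "A \<in> sets borel" "A \<subseteq> egg_boundary m"
  shows "emeasure (egg_model m) A =
    (\<integral>\<^sup>+u\<in>egg_box \<inter> egg_param m -` A. ennreal (egg_density m u) \<partial>lborel)"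
proof -
  have [measurable]: "A \<in> sets (egg_model m)"
    using A closed_egg_boundary by (simp add: sets_egg_model sets_restrict_space_iff)
  have "emeasure (egg_model m) A = (\<integral>\<^sup>+p. indicator A p \<partial>egg_model m)"
    by simp
  also have "\<dots> = (\<integral>\<^sup>+u\<in>egg_box. indicator A (egg_param m u) * ennreal (egg_density m u) \<partial>lborel)"
    by (rule nn_integral_egg_model[OF m]) simp
  also have "\<dots> = (\<integral>\<^sup>+u\<in>egg_box \<inter> egg_param m -` A. ennreal (egg_density m u) \<partial>lborel)"
    by (intro nn_integral_cong) (auto simp: indicator_def)
  finally show ?thesis .
qed

lemma egg_density_integrable:
  assumes "S \<subseteq> egg_box" "S \<in> sets borel"
  shows "egg_density m absolutely_integrable_on S"
proof -
  have "egg_box \<subseteq> cbox (\<chi> i. - pi) (\<chi> i. pi)"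
  proof
    fix u assume "u \<in> egg_box"
    then show "u \<in> cbox (\<chi> i. - pi) (\<chi> i. pi)"
      using abs_Re_le_cmod[of "Complex (u $ 1) (u $ 2)"] abs_Im_le_cmod[of "Complex (u $ 1) (u $ 2)"] pi_ge_two
      by (auto simp: mem_box_cart forall_3 egg_box_def abs_le_iff)
  qed
  with assms have "S \<subseteq> cbox (\<chi> i. - pi) (\<chi> i. pi)" by auto
  moreover have "egg_density m absolutely_integrable_on cbox (\<chi> i. - pi) (\<chi> i. pi)"
    by (intro absolutely_integrable_continuous continuous_on_egg_density)
  ultimately show ?thesis
    using assms by (intro set_integrable_subset[where A="cbox _ _" and B=S]) auto
qed

text \<open>Off the cut, \<open>egg_coord\<close> composed with the given parametrisation is an
  injective differentiable map between subsets of R^3. Its Jacobian is exactly the determinant in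
  \<open>leray_levi_egg_tangent\<close>, so changing variables turns the model density into the
  pulled-back form.\<close>

lemma is_form_measure_egg_model:
  assumes m: "m \<ge> 1"
  shows "is_form_measure (egg_boundary m) (leray_levi_form (egg_rho m)) (egg_model m)"
  unfolding is_form_measure_def
proof (intro conjI allI impI ballI)
  show "sets (egg_model m) = sets (restrict_space borel (egg_boundary m))"
    by (rule sets_egg_model)
  fix U \<phi> and A :: "(complex ^ 2) set"
  assume par: "local_param3 (egg_boundary m) U \<phi>" and A: "A \<in> sets borel"
  let ?F = "\<lambda>u. frechet_derivative \<phi> (at u)"
  let ?\<omega> = "leray_levi_form (egg_rho m)"
  have U: "open U" and inj: "inj_on \<phi> U" and img: "\<phi> ` U \<subseteq> egg_boundary m"
    using par by (auto simp: local_param3_def)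
  have cont: "continuous_on U \<phi>" by (rule local_param3_continuous_on[OF par])
  have AU: "A \<inter> \<phi> ` U \<in> sets borel"
    using A borel_continuous_image_open[OF U cont] by auto
  define S where "S = {u \<in> U. \<phi> u $ 1 \<notin> \<real>\<^sub>\<le>\<^sub>0 \<and> \<phi> u \<in> A}"
  define \<psi> where "\<psi> = egg_coord \<circ> \<phi>"
  define \<psi>' where "\<psi>' u = egg_coord_deriv (\<phi> u) \<circ> ?F u" for u
  have "S \<in> sets borel"
  proof -
    have [measurable]: "\<phi> \<in> borel_measurable (restrict_space borel U)"
      using cont by (rule borel_measurable_continuous_on_restrict)
    have "closed {p :: complex ^ 2. p $ 1 \<in> \<real>\<^sub>\<le>\<^sub>0}"
      using closed_vimage[OF closed_nonpos_Reals_complex, of "\<lambda>p :: complex ^ 2. p $ 1"]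
      by (simp add: vimage_def continuous_on_component)
    then have "A - {p. p $ 1 \<in> \<real>\<^sub>\<le>\<^sub>0} \<in> sets borel" using A by auto
    from measurable_sets[OF _ this, of \<phi> "restrict_space borel U"]
    have "\<phi> -` (A - {p. p $ 1 \<in> \<real>\<^sub>\<le>\<^sub>0}) \<inter> U \<in> sets (restrict_space borel U)"
      by (simp add: space_restrict_space)
    moreover have "\<phi> -` (A - {p. p $ 1 \<in> \<real>\<^sub>\<le>\<^sub>0}) \<inter> U = S" by (auto simp: S_def)
    ultimately show ?thesis using U by (simp add: sets_restrict_space_iff)
  qed
  have \<psi>S: "\<psi> ` S = egg_box \<inter> egg_param m -` (A \<inter> \<phi> ` U)"
  proof (intro set_eqI iffI)
    fix v assume "v \<in> \<psi> ` S"
    then obtain u where u: "u \<in> S" "v = egg_coord (\<phi> u)" by (auto simp: \<psi>_def)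
    then have "\<phi> u \<in> egg_boundary m" "\<phi> u $ 1 \<notin> \<real>\<^sub>\<le>\<^sub>0" using img by (auto simp: S_def)
    then show "v \<in> egg_box \<inter> egg_param m -` (A \<inter> \<phi> ` U)"
      using u egg_coord_in_box[OF m] egg_param_coord by (auto simp: S_def)
  next
    fix v assume v: "v \<in> egg_box \<inter> egg_param m -` (A \<inter> \<phi> ` U)"
    then obtain u where u: "u \<in> U" "egg_param m v = \<phi> u" "\<phi> u \<in> A" by auto
    then have "u \<in> S" "v = \<psi> u"
      using v egg_coord_param[OF m, of v] by (auto simp: S_def \<psi>_def)
    then show "v \<in> \<psi> ` S" by blast
  qed
  have "emeasure (egg_model m) (A \<inter> \<phi> ` U) = (\<integral>\<^sup>+v\<in>\<psi> ` S. ennreal (egg_density m v) \<partial>lborel)"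
    unfolding \<psi>S using AU img by (intro emeasure_egg_model[OF m]) auto
  also have "\<dots> = (\<integral>\<^sup>+u\<in>S. ennreal (\<bar>det (matrix (\<psi>' u))\<bar> * egg_density m (\<psi> u)) \<partial>lborel)"
  proof (rule nn_integral_change_of_variables)
    show "S \<in> sets lebesgue" using \<open>S \<in> sets borel\<close> by simp
    show "(\<psi> has_derivative \<psi>' u) (at u within S)" if "u \<in> S" for u
    proof (rule has_derivative_at_withinI)
      have "(egg_coord has_derivative egg_coord_deriv (\<phi> u)) (at (\<phi> u))"
        using that by (intro has_derivative_egg_coord) (auto simp: S_def)
      with local_param3_has_derivative[OF par, of u]
      show "(\<psi> has_derivative \<psi>' u) (at u)"
        using that unfolding \<psi>_def \<psi>'_def S_def by (auto intro: diff_chain_at)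
    qed
    show "inj_on \<psi> S"
    proof (rule inj_onI)
      fix u v assume *: "u \<in> S" "v \<in> S" "\<psi> u = \<psi> v"
      then have "\<phi> u \<in> egg_boundary m" "\<phi> v \<in> egg_boundary m" "egg_coord (\<phi> u) = egg_coord (\<phi> v)"
        using img by (auto simp: \<psi>_def S_def)
      then have "\<phi> u = \<phi> v"
        by (metis egg_param_coord)
      then show "u = v" using inj * by (auto simp: S_def inj_on_def)
    qed
    have "egg_box \<inter> egg_param m -` (A \<inter> \<phi> ` U) \<in> sets borel"
      using measurable_sets[OF borel_measurable_egg_param AU] borel_egg_box by auto
    then show "egg_density m absolutely_integrable_on \<psi> ` S"
      unfolding \<psi>S by (intro egg_density_integrable) auto
    show "0 \<le> egg_density m v" for v by (simp add: egg_density_def)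
  qed
  also have "\<dots> = (\<integral>\<^sup>+u\<in>U. indicator A (\<phi> u) * ennreal (cmod (pullback3 ?\<omega> \<phi> u)) \<partial>lborel)"
  proof (rule nn_integral_cong_AE)
    \<comment> \<open>\<open>S\<close> omits the parameters over the cut; they lie among those with
      Im z = 0, a null set.\<close>
    have "AE u in lborel. \<not> (u \<in> U \<and> Im (\<phi> u $ 1) = 0)"
      using negligible_Im_fst[OF m par]
      by (auto simp: negligible_iff_null_sets AE_completion_iff dest!: AE_not_in)
    then show "AE u in lborel. ennreal (\<bar>det (matrix (\<psi>' u))\<bar> * egg_density m (\<psi> u)) * indicator S u =
      indicator A (\<phi> u) * ennreal (cmod (pullback3 ?\<omega> \<phi> u)) * indicator U u"
    proof (rule AE_mp, intro AE_I2 impI)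
      fix u :: "real ^ 3" assume *: "\<not> (u \<in> U \<and> Im (\<phi> u $ 1) = 0)"
      show "ennreal (\<bar>det (matrix (\<psi>' u))\<bar> * egg_density m (\<psi> u)) * indicator S u =
        indicator A (\<phi> u) * ennreal (cmod (pullback3 ?\<omega> \<phi> u)) * indicator U u"
      proof (cases "u \<in> U \<and> \<phi> u \<in> A")
        case True
        then have z: "\<phi> u $ 1 \<notin> \<real>\<^sub>\<le>\<^sub>0" "\<phi> u $ 1 \<noteq> 0" and uS: "u \<in> S"
          using * by (auto simp: S_def complex_nonpos_Reals_iff)
        have p: "\<phi> u \<in> egg_boundary m" using True img by auto
        have "cmod (pullback3 ?\<omega> \<phi> u) = egg_hess m (\<phi> u) / (2 * pi\<^sup>2) *
           \<bar>det (\<chi> i j. egg_coord_deriv (\<phi> u) (?F u (axis j 1)) $ i)\<bar>"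
          unfolding pullback3_def using True
          by (intro leray_levi_egg_tangent[OF m p z(2)] egg_tangent[OF par]) auto
        also have "(\<chi> i j. egg_coord_deriv (\<phi> u) (?F u (axis j 1)) $ i) = matrix (\<psi>' u)"
          by (simp add: matrix_def \<psi>'_def)
        also have "egg_hess m (\<phi> u) / (2 * pi\<^sup>2) = egg_density m (\<psi> u)"
          by (simp add: egg_hess_def egg_density_def \<psi>_def egg_coord_def)
        finally show ?thesis using True uS by (simp add: mult.commute)
      next
        case False
        then show ?thesis by (auto simp: S_def indicator_def)
      qed
    qed
  qed
  finally show "emeasure (egg_model m) (A \<inter> \<phi> ` U) =
    (\<integral>\<^sup>+u\<in>U. indicator A (\<phi> u) * ennreal (cmod (pullback3 ?\<omega> \<phi> u)) \<partial>lborel)" .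
qed

section \<open>Uniqueness of the boundary measure\<close>

text \<open>A Borel set is cut into countably many disjoint pieces, each inside the image of one
  chart, where the defining integral determines the measure.\<close>

lemma form_measure_unique:
  assumes \<mu>: "is_form_measure M \<omega> \<mu>" and \<nu>: "is_form_measure M \<omega> \<nu>" and M: "M \<in> sets borel"
    and par: "\<And>j::nat. local_param3 M (U j) (\<phi> j)" and cover: "M \<subseteq> (\<Union>j. \<phi> j ` U j)"
  shows "\<mu> = \<nu>"
proof (rule measure_eqI)
  have sets: "sets \<mu> = sets (restrict_space borel M)" "sets \<nu> = sets (restrict_space borel M)"
    using \<mu> \<nu> by (auto simp: is_form_measure_def)
  then show "sets \<mu> = sets \<nu>" by simp
  fix A assume "A \<in> sets \<mu>"
  then have A: "A \<in> sets borel" "A \<subseteq> M"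
    using M by (auto simp: sets sets_restrict_space_iff)
  define V where "V j = \<phi> j ` U j" for j
  have V: "range V \<subseteq> sets borel"
    unfolding V_def using par local_param3_continuous_on[OF par]
    by (auto simp: local_param3_def intro!: borel_continuous_image_open)
  define B where "B j = A \<inter> disjointed V j" for j
  have B: "B j \<in> sets borel" for j
    unfolding B_def using A sets.range_disjointed_sets[OF V] by auto
  have Bsets: "range B \<subseteq> sets \<mu>" "range B \<subseteq> sets \<nu>"
    using B A M by (auto simp: sets sets_restrict_space_iff B_def)
  have disj: "disjoint_family B"
    using disjoint_family_disjointed[of V] by (auto simp: disjoint_family_on_def B_def)
  have UB: "(\<Union>j. B j) = A"
    using A cover UN_disjointed_eq[of V] by (auto simp: B_def V_def)
  have BV: "B j = B j \<inter> \<phi> j ` U j" for j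
    using disjointed_subset[of V j] by (auto simp: B_def V_def)
  have "emeasure \<mu> (B j) = emeasure \<nu> (B j)" for j
    using \<mu> \<nu> B[of j] par[of j] by (subst (1 2) BV) (simp add: is_form_measure_def)
  then show "emeasure \<mu> A = emeasure \<nu> A"
    using suminf_emeasure[OF Bsets(1) disj] suminf_emeasure[OF Bsets(2) disj] by (simp add: UB)
qed

section \<open>Polar charts covering the boundary\<close>

text \<open>The modulus of the coordinate that is put in polar form, solved from the boundary
  equation: p = m and q = 1/2 if this coordinate is z, p = 1 and q = 1/(2m) if it is w.\<close>

definition polar_radius :: "nat \<Rightarrow> real \<Rightarrow> real ^ 3 \<Rightarrow> real" where
  "polar_radius p q u = (1 - ((u $ 1)\<^sup>2 + (u $ 2)\<^sup>2) ^ p) powr q"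

definition polar_param :: "2 \<Rightarrow> nat \<Rightarrow> real \<Rightarrow> real ^ 3 \<Rightarrow> complex ^ 2" where
  "polar_param i p q u = (\<chi> k. if k = i then of_real (polar_radius p q u) * cis (u $ 3)
    else Complex (u $ 1) (u $ 2))"

text \<open>\<open>t\<close> is the centre of the window of angles; 0 and pi together reach every
  direction.\<close>

definition polar_box :: "real \<Rightarrow> (real ^ 3) set" where
  "polar_box t = {u. (u $ 1)\<^sup>2 + (u $ 2)\<^sup>2 < 1 \<and> t - pi < u $ 3 \<and> u $ 3 < t + pi}"

lemma open_polar_box: "open (polar_box t)"
  unfolding polar_box_def by (intro open_Collect_conj open_Collect_less continuous_intros)

lemma polar_box_less_1:
  assumes "p \<ge> 1" "u \<in> polar_box t"
  shows "((u $ 1)\<^sup>2 + (u $ 2)\<^sup>2) ^ p < 1"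
  using power_strict_mono[of "(u $ 1)\<^sup>2 + (u $ 2)\<^sup>2" 1 p] assms by (simp add: polar_box_def)

lemma polar_radius_has_derivative:
  assumes p: "p \<ge> 1"
  obtains r' where
    "\<And>t u. u \<in> polar_box t \<Longrightarrow> (polar_radius p q has_derivative r' u) (at u)"
    "\<And>t v. continuous_on (polar_box t) (\<lambda>u. r' u v)"
proof
  define s where "s u = (u $ 1)\<^sup>2 + (u $ 2)\<^sup>2" for u :: "real ^ 3"
  define g' where "g' x = - (q * (1 - x ^ p) powr (q - 1) * (real p * x ^ (p - 1)))" for x :: real
  define r' where "r' u v = g' (s u) * (2 * u $ 1 * v $ 1 + 2 * u $ 2 * v $ 2)" for u v :: "real ^ 3"
  show "(polar_radius p q has_derivative r' u) (at u)" if u: "u \<in> polar_box t" for t u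
  proof -
    have nth: "((\<lambda>u. u $ i) has_derivative (\<lambda>h. h $ i)) (at u)" for i :: 3
      by (rule bounded_linear.has_derivative[OF bounded_linear_vec_nth has_derivative_ident])
    have s: "(s has_derivative (\<lambda>v. 2 * u $ 1 * v $ 1 + 2 * u $ 2 * v $ 2)) (at u)"
      unfolding s_def by (auto intro!: derivative_eq_intros nth)
    have "((\<lambda>x. (1 - x ^ p) powr q) has_real_derivative g' (s u)) (at (s u))"
      using polar_box_less_1[OF p u] unfolding g'_def s_def
      by (auto intro!: derivative_eq_intros)
    then have "((\<lambda>x. (1 - x ^ p) powr q) has_derivative (\<lambda>h. g' (s u) * h)) (at (s u))"
      by (rule has_field_derivative_imp_has_derivative)
    from has_derivative_compose[OF s this]
    show ?thesis by (simp add: polar_radius_def[abs_def] s_def r'_def[abs_def])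
  qed
  show "continuous_on (polar_box t) (\<lambda>u. r' u v)" for t v
    unfolding r'_def g'_def s_def
    by (intro continuous_intros) (use polar_box_less_1[OF p] in \<open>fastforce+\<close>)
qed

lemma cis_eq_imp_eq:
  assumes "cis a = cis b" "\<bar>a - b\<bar> < 2 * pi"
  shows "a = b"
proof -
  have "cis (a - b) = 1" using assms(1) by (simp flip: cis_divide)
  then have "cos (a - b) = 1" by (simp add: complex_eq_iff)
  then obtain n :: int where n: "a - b = of_int n * 2 * pi"
    using cos_one_2pi_int[of "a - b"] by auto
  then have "\<bar>real_of_int n\<bar> < 1" using assms(2) by (simp add: abs_mult)
  then have "n = 0" by linarith
  then show ?thesis using n by simp
qed

text \<open>The derivative is injective because the Cartesian coordinate \<open>j\<close> shows the
  first two components, and the polar one then shows the third, multiplied by the positive radius.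
  The window of length 2 pi makes the angle unique.\<close>

lemma local_param3_polar:
  assumes p: "p \<ge> 1" and M: "polar_param i p q ` polar_box t \<subseteq> M"
  shows "local_param3 M (polar_box t) (polar_param i p q)"
proof -
  obtain j :: 2 where j: "j \<noteq> i" by (metis exhaust_2 zero_neq_one one_neq_zero num1_eq1)
  obtain r' where r': "\<And>t u. u \<in> polar_box t \<Longrightarrow> (polar_radius p q has_derivative r' u) (at u)"
    "\<And>t v. continuous_on (polar_box t) (\<lambda>u. r' u v)"
    using polar_radius_has_derivative[OF p] by metis
  let ?r = "polar_radius p q"
  have pos: "?r u > 0" if "u \<in> polar_box t" for u
    using polar_box_less_1[OF p that] by (simp add: polar_radius_def)
  define D where "D u v = (\<chi> k. if k = i
      then (of_real (r' u v) + \<i> * of_real (?r u * v $ 3)) * cis (u $ 3)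
      else Complex (v $ 1) (v $ 2))" for u v :: "real ^ 3"
  have der: "(polar_param i p q has_derivative D u) (at u)" if u: "u \<in> polar_box t" for u
  proof -
    have nth: "((\<lambda>u. u $ i) has_derivative (\<lambda>h. h $ i)) (at u)" for i :: 3
      by (rule bounded_linear.has_derivative[OF bounded_linear_vec_nth has_derivative_ident])
    have ofr: "((\<lambda>u. complex_of_real (f u)) has_derivative (\<lambda>h. of_real (f' h))) (at u)"
      if "(f has_derivative f') (at u)" for f f'
      by (rule bounded_linear.has_derivative[OF bounded_linear_of_real that])
    have "((\<lambda>u. \<i> * complex_of_real (u $ 3)) has_derivative (\<lambda>v. \<i> * of_real (v $ 3))) (at u)"
      by (intro has_derivative_mult_right ofr nth)
    from has_derivative_compose[OF this has_field_derivative_imp_has_derivative[OF DERIV_exp]]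
    have exp: "((\<lambda>u. exp (\<i> * complex_of_real (u $ 3))) has_derivative
      (\<lambda>v. exp (\<i> * of_real (u $ 3)) * (\<i> * of_real (v $ 3)))) (at u)" .
    have 1: "((\<lambda>u. of_real (?r u) * exp (\<i> * of_real (u $ 3))) has_derivative
      (\<lambda>v. (of_real (r' u v) + \<i> * of_real (?r u * v $ 3)) * exp (\<i> * of_real (u $ 3)))) (at u)"
      by (rule has_derivative_eq_rhs[OF has_derivative_mult[OF ofr[OF r'(1)[OF u]] exp]])
        (simp add: fun_eq_iff algebra_simps)
    have 2: "((\<lambda>u. Complex (u $ 1) (u $ 2)) has_derivative (\<lambda>v. Complex (v $ 1) (v $ 2))) (at u)"
      unfolding Complex_eq by (auto intro!: derivative_eq_intros ofr nth)
    have "((\<lambda>u. polar_param i p q u $ k) has_derivative (\<lambda>v. D u v $ k)) (at u)" for k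
      using 1 2 by (cases "k = i") (simp_all add: polar_param_def D_def cis_conv_exp)
    then show ?thesis
      by (subst has_derivative_componentwise_within)
        (auto simp: Basis_vec_def inner_axis intro!: derivative_eq_intros)
  qed
  then have fd: "frechet_derivative (polar_param i p q) (at u) = D u" if "u \<in> polar_box t" for u
    using that frechet_derivative_at by metis
  have "inj (D u)" if u: "u \<in> polar_box t" for u
  proof -
    have "v = 0" if "D u v = 0" for v
    proof -
      have "D u v $ i = 0" "D u v $ j = 0" using that by auto
      then have "of_real (r' u v) + \<i> * of_real (?r u * v $ 3) = 0" "Complex (v $ 1) (v $ 2) = 0"
        using j by (auto simp: D_def)
      then show ?thesis
        using pos[OF u] by (auto simp: complex_eq_iff vec_eq_iff forall_3)
    qed
    then show ?thesis
      using linear_injective_0[OF has_derivative_linear[OF der[OF u]]] by blast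
  qed
  moreover have "continuous_on (polar_box t) (\<lambda>u. D u v)" for v
  proof -
    have r: "continuous_on (polar_box t) ?r"
      using r'(1) has_derivative_continuous by (metis continuous_at_imp_continuous_on)
    have "continuous_on (polar_box t) (\<lambda>u. D u v $ k)" for k
      by (cases "k = i") (simp_all add: D_def cis_conv_exp, intro continuous_intros r r')
    then have "continuous_on (polar_box t) (\<lambda>u. \<chi> k. D u v $ k)"
      by (intro continuous_on_vec_lambda)
    then show ?thesis by simp
  qed
  then have "continuous_on (polar_box t) (\<lambda>u. frechet_derivative (polar_param i p q) (at u) v)" for v
    by (rule continuous_on_eq) (simp add: fd)
  moreover have "inj_on (polar_param i p q) (polar_box t)"
  proof (rule inj_onI)
    fix u v assume u: "u \<in> polar_box t" and v: "v \<in> polar_box t"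
      and eq: "polar_param i p q u = polar_param i p q v"
    from arg_cong[OF eq, of "\<lambda>x. x $ j"] have 12: "u $ 1 = v $ 1" "u $ 2 = v $ 2"
      using j by (auto simp: polar_param_def)
    then have "?r u = ?r v" by (simp add: polar_radius_def)
    with arg_cong[OF eq, of "\<lambda>x. x $ i"] have "cis (u $ 3) = cis (v $ 3)"
      using pos[OF v] by (simp add: polar_param_def)
    moreover have "\<bar>u $ 3 - v $ 3\<bar> < 2 * pi" using u v by (auto simp: polar_box_def abs_less_iff)
    ultimately have "u $ 3 = v $ 3" by (rule cis_eq_imp_eq)
    with 12 show "u = v" by (simp add: vec_eq_iff forall_3)
  qed
  ultimately show ?thesis
    unfolding local_param3_def using M open_polar_box der fd
    by (auto simp: differentiable_def) blast
qed

definition egg_polar_param :: "nat \<Rightarrow> 2 \<Rightarrow> real ^ 3 \<Rightarrow> complex ^ 2" where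
  "egg_polar_param m i = (if i = 1 then polar_param 1 m (1/2) else polar_param 2 1 (1 / (2 * real m)))"

lemma local_param3_egg_polar:
  assumes m: "m \<ge> 1"
  shows "local_param3 (egg_boundary m) (polar_box t) (egg_polar_param m i)"
proof (cases "i = 1")
  case True
  show ?thesis
    unfolding egg_polar_param_def True if_P[OF refl]
  proof (rule local_param3_polar[OF m], rule image_subsetI)
    fix u assume u: "u \<in> polar_box t"
    have "(cmod (polar_param 1 m (1/2) u $ 1))\<^sup>2 = 1 - ((u $ 1)\<^sup>2 + (u $ 2)\<^sup>2) ^ m"
      using polar_box_less_1[OF m u]
      by (simp add: polar_param_def polar_radius_def norm_mult powr_half_sqrt)
    then show "polar_param 1 m (1/2) u \<in> egg_boundary m"
      by (simp add: egg_boundary_def) (simp add: polar_param_def power_mult cmod_power2)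
  qed
next
  case False
  then have i: "i = 2" using exhaust_2 by blast
  have "egg_polar_param m i = polar_param 2 1 (1 / (2 * real m))"
    by (simp add: egg_polar_param_def i)
  moreover have "local_param3 (egg_boundary m) (polar_box t) (polar_param 2 1 (1 / (2 * real m)))"
  proof (rule local_param3_polar, simp, rule image_subsetI)
    fix u assume u: "u \<in> polar_box t"
    let ?x = "1 - ((u $ 1)\<^sup>2 + (u $ 2)\<^sup>2)"
    have x: "?x > 0" using u by (simp add: polar_box_def)
    have "cmod (polar_param 2 1 (1 / (2 * real m)) u $ 2) ^ (2 * m) = (?x powr (1 / (2 * real m))) ^ (2 * m)"
      by (simp add: polar_param_def polar_radius_def norm_mult)
    also have "\<dots> = ?x"
      using x m by (simp add: powr_powr flip: powr_realpow)
    finally show "polar_param 2 1 (1 / (2 * real m)) u \<in> egg_boundary m"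
      by (simp add: egg_boundary_def) (simp add: polar_param_def cmod_power2)
  qed
  ultimately show ?thesis by simp
qed

text \<open>If z is nonzero, then |w| < 1 and the chart polar in z applies. If z = 0, then |w| = 1
  and the point lies over the centre of the disc in the chart polar in w. The window around 0 misses
  only the angle pi among the values of \<open>Arg\<close>.\<close>

lemma egg_polar_cover:
  assumes m: "m \<ge> 1" and x: "x \<in> egg_boundary m"
  shows "\<exists>i. \<exists>t\<in>{0, pi}. x \<in> egg_polar_param m i ` polar_box t"
proof -
  have sum: "(cmod (x $ 1))\<^sup>2 + cmod (x $ 2) ^ (2 * m) = 1"
    using x by (simp add: egg_boundary_def)
  have lt1: "c < 1" if "c ^ k < 1" "c \<ge> 0" for c :: real and k
    using that one_le_power[of c k] by linarith
  have arg: "\<exists>t\<in>{0, pi}. t - pi < Arg z \<and> Arg z < t + pi" for z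
    using mpi_less_Arg[of z] Arg_le_pi[of z] by (cases "Arg z = pi") auto
  have polar: "z = of_real (cmod z) * cis (Arg z)" for z
    by (cases "z = 0") (simp_all add: Arg_eq cis_conv_exp)
  show ?thesis
  proof (cases "x $ 1 = 0")
    case False
    define u :: "real ^ 3" where "u = vector [Re (x $ 2), Im (x $ 2), Arg (x $ 1)]"
    have "cmod (x $ 2) ^ (2 * m) < 1" using sum False
      by (smt (verit) zero_less_norm_iff zero_less_power)
    then have "cmod (x $ 2) < 1" by (rule lt1) simp
    then have "(cmod (x $ 2))\<^sup>2 < 1" by (simp add: abs_square_less_1)
    moreover obtain t where "t \<in> {0, pi}" "t - pi < Arg (x $ 1) \<and> Arg (x $ 1) < t + pi"
      using arg[of "x $ 1"] by blast
    ultimately have t: "t \<in> {0, pi}" "u \<in> polar_box t"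
      by (auto simp: polar_box_def u_def cmod_power2)
    have "polar_radius m (1/2) u = cmod (x $ 1)"
    proof -
      have "polar_radius m (1/2) u = (1 - cmod (x $ 2) ^ (2 * m)) powr (1/2)"
        by (simp add: polar_radius_def u_def power_mult cmod_power2)
      also have "1 - cmod (x $ 2) ^ (2 * m) = (cmod (x $ 1))\<^sup>2" using sum by simp
      finally show ?thesis by (simp add: powr_half_sqrt)
    qed
    then have "x = egg_polar_param m 1 u"
      using polar[of "x $ 1"]
      by (simp add: egg_polar_param_def polar_param_def vec_eq_iff forall_2) (simp add: u_def)
    with t show ?thesis by blast
  next
    case True
    define u :: "real ^ 3" where "u = vector [0, 0, Arg (x $ 2)]"
    obtain t where "t \<in> {0, pi}" "t - pi < Arg (x $ 2) \<and> Arg (x $ 2) < t + pi"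
      using arg[of "x $ 2"] by blast
    then have t: "t \<in> {0, pi}" "u \<in> polar_box t"
      by (auto simp: polar_box_def u_def)
    have "cmod (x $ 2) = 1"
      using sum True m power_eq_iff_eq_base[of "2 * m" "cmod (x $ 2)" 1] by simp
    then have "x = egg_polar_param m 2 u"
      using polar[of "x $ 2"] True
      by (simp add: egg_polar_param_def polar_param_def vec_eq_iff forall_2 polar_radius_def)
        (simp add: u_def Complex_eq)
    with t show ?thesis by blast
  qed
qed

lemma egg_S_eq_model:
  assumes m: "m \<ge> 1"
  shows "egg_S m = egg_model m"
  unfolding egg_S_def form_measure_def egg_frontier[OF m]
proof (rule the_equality)
  show model: "is_form_measure (egg_boundary m) (leray_levi_form (egg_rho m)) (egg_model m)"
    by (rule is_form_measure_egg_model[OF m])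
  fix \<mu> assume \<mu>: "is_form_measure (egg_boundary m) (leray_levi_form (egg_rho m)) \<mu>"
  \<comment> \<open>The indices 0 to 3 enumerate the four charts: j < 2 selects the window, the
    parity selects the polar coordinate. Larger indices repeat charts.\<close>
  define U where "U j = polar_box (if j < 2 then 0 else pi)" for j :: nat
  define \<phi> where "\<phi> j = egg_polar_param m (if even j then 1 else 2)" for j :: nat
  show "\<mu> = egg_model m"
  proof (rule form_measure_unique[OF \<mu> model])
    show "egg_boundary m \<in> sets borel" using closed_egg_boundary by simp
    show "local_param3 (egg_boundary m) (U j) (\<phi> j)" for j
      unfolding U_def \<phi>_def by (rule local_param3_egg_polar[OF m])
    show "egg_boundary m \<subseteq> (\<Union>j. \<phi> j ` U j)"
    proof
      fix x assume "x \<in> egg_boundary m"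
      then obtain i t where it: "t \<in> {0, pi}" "x \<in> egg_polar_param m i ` polar_box t"
        using egg_polar_cover[OF m] by blast
      define j :: nat where "j = (if i = 1 then 0 else 1) + (if t = 0 then 0 else 2)"
      have "i = 1 \<or> i = 2" by (rule exhaust_2)
      then have "x \<in> \<phi> j ` U j" using it by (auto simp: \<phi>_def U_def j_def)
      then show "x \<in> (\<Union>j. \<phi> j ` U j)" by blast
    qed
  qed
qed

section \<open>Quasimetric geometry of the boundary\<close>

text \<open>Jordan's inequality: by concavity the graph lies above the chord from 0 to pi /
  2.\<close>

lemma sin_ge_linear:
  assumes "0 \<le> x" "x \<le> pi / 2"
  shows "2 * x / pi \<le> sin x"
proof -
  have "concave_on {0..pi} sin"
    by (rule f''_le0_imp_concave[where f' = cos and f'' = "\<lambda>x. - sin x"])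
       (auto intro!: derivative_eq_intros simp: sin_ge_zero)
  from concave_onD[OF this, of "2 * x / pi" 0 "pi / 2"] assms show ?thesis
    by (simp add: field_simps)
qed

lemma norm_cis_diff: "cmod (cis a - cis b) = 2 * \<bar>sin ((a - b) / 2)\<bar>"
proof -
  have "cis a - cis b = cis b * (cis (a - b) - 1)"
    by (simp add: algebra_simps cis_mult)
  then show ?thesis
    using dist_exp_i_1[of "a - b"] by (simp add: norm_mult cis_conv_exp)
qed

lemma norm_cis_diff_le: "cmod (cis a - cis b) \<le> \<bar>a - b\<bar>"
  using abs_sin_x_le_abs_x[of "(a - b) / 2"] by (simp add: norm_cis_diff)

lemma norm_cis_diff_ge:
  assumes "\<bar>a - b\<bar> \<le> pi"
  shows "2 / pi * \<bar>a - b\<bar> \<le> cmod (cis a - cis b)"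
proof -
  have "2 * (\<bar>a - b\<bar> / 2) / pi \<le> sin (\<bar>a - b\<bar> / 2)"
    by (rule sin_ge_linear) (use assms in auto)
  also have "\<dots> \<le> \<bar>sin ((a - b) / 2)\<bar>"
  proof -
    have "sin ((b - a) / 2) = - sin ((a - b) / 2)"
      by (metis minus_diff_eq minus_divide_left sin_minus)
    then show ?thesis by (cases "a \<ge> b") auto
  qed
  finally show ?thesis by (simp add: norm_cis_diff)
qed

lemma abs_power_diff_le:
  fixes a b M :: real
  assumes "\<bar>a\<bar> \<le> M" "\<bar>b\<bar> \<le> M"
  shows "\<bar>a ^ n - b ^ n\<bar> \<le> real n * M ^ (n - 1) * \<bar>a - b\<bar>"
proof (cases "M = 0 \<or> n = 0")
  case True
  then show ?thesis using assms by auto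
next
  case False
  then have M: "M > 0" and n: "n > 0" using assms by auto
  have "norm ((a / M) ^ n - (b / M) ^ n) \<le> n * norm (a / M - b / M)"
    using assms M by (intro norm_power_diff) auto
  then have "M ^ n * \<bar>(a / M) ^ n - (b / M) ^ n\<bar> \<le> M ^ n * (n * \<bar>a / M - b / M\<bar>)"
    using M by (intro mult_left_mono) auto
  moreover have "M ^ n * \<bar>(a / M) ^ n - (b / M) ^ n\<bar> = \<bar>a ^ n - b ^ n\<bar>"
  proof -
    have "(a / M) ^ n - (b / M) ^ n = (a ^ n - b ^ n) / M ^ n"
      by (simp add: power_divide diff_divide_distrib)
    then show ?thesis using M by (simp add: abs_divide)
  qed
  moreover have "M ^ n * (n * \<bar>a / M - b / M\<bar>) = real n * M ^ (n - 1) * \<bar>a - b\<bar>"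
  proof -
    have "a / M - b / M = (a - b) / M" by (simp add: diff_divide_distrib)
    moreover have "M ^ n = M * M ^ (n - 1)" using n by (cases n) auto
    ultimately show ?thesis using M by (simp add: abs_divide)
  qed
  ultimately show ?thesis by simp
qed

section \<open>Consequences of a small quasidistance\<close>

text \<open>The right-hand side exceeds the left by (|w|^n - |v|^n)(|w|^2 - |v|^2), whose factors
  never have opposite signs.\<close>

lemma weighted_monotonicity:
  fixes w v :: complex
  shows "(cmod w ^ n + cmod v ^ n) * (cmod (w - v))\<^sup>2 \<le>
    2 * Re ((cnj w * of_real (cmod w ^ n) - cnj v * of_real (cmod v ^ n)) * (w - v))"
proof -
  define a where "a = cmod w ^ n"
  define b where "b = cmod v ^ n"
  have "0 \<le> (a - b) * ((cmod w)\<^sup>2 - (cmod v)\<^sup>2)"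
  proof (cases "cmod w \<ge> cmod v")
    case True
    then show ?thesis by (auto simp: a_def b_def intro!: mult_nonneg_nonneg power_mono)
  next
    case False
    then show ?thesis by (auto simp: a_def b_def intro!: mult_nonpos_nonpos power_mono)
  qed
  moreover have "2 * Re ((cnj w * of_real a - cnj v * of_real b) * (w - v)) =
    (a + b) * (cmod (w - v))\<^sup>2 + (a - b) * ((cmod w)\<^sup>2 - (cmod v)\<^sup>2)"
    unfolding cmod_power2 by (simp add: algebra_simps power2_eq_square)
  ultimately show ?thesis by (simp add: a_def b_def)
qed

text \<open>Symmetrising turns v into the pairing of the difference of the gradients with p - q. Its
  real part is at most the quasidistance, and both summands are nonnegative.\<close>

lemma egg_v_symmetric_sum:
  "Re (egg_v m p q + egg_v m q p) = (cmod (p $ 1 - q $ 1))\<^sup>2 +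
    m * Re ((cnj (p $ 2) * of_real (cmod (p $ 2) ^ (2 * m - 2))
      - cnj (q $ 2) * of_real (cmod (q $ 2) ^ (2 * m - 2))) * (p $ 2 - q $ 2))"
proof -
  have "Re (cnj a * (a - b) + cnj b * (b - a)) = (cmod (a - b))\<^sup>2" for a b
    unfolding cmod_power2 by (simp add: algebra_simps power2_eq_square)
  moreover have "egg_v m p q + egg_v m q p =
    (cnj (p $ 1) * (p $ 1 - q $ 1) + cnj (q $ 1) * (q $ 1 - p $ 1)) +
    of_real (real m) * ((cnj (p $ 2) * of_real (cmod (p $ 2) ^ (2 * m - 2))
      - cnj (q $ 2) * of_real (cmod (q $ 2) ^ (2 * m - 2))) * (p $ 2 - q $ 2))"
    unfolding egg_v_def by (simp add: algebra_simps)
  ultimately show ?thesis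
    by (simp only: plus_complex.sel Re_complex_of_real Im_complex_of_real times_complex.sel(1)[of "of_real _"] mult_zero_left diff_zero)
qed

lemma egg_dist_snd:
  assumes "m \<ge> 1"
  shows "(cmod (p $ 2) ^ (2 * m - 2) + cmod (q $ 2) ^ (2 * m - 2)) * (cmod (p $ 2 - q $ 2))\<^sup>2
    \<le> 2 * egg_dist m p q"
proof -
  let ?E = "(cmod (p $ 2) ^ (2 * m - 2) + cmod (q $ 2) ^ (2 * m - 2)) * (cmod (p $ 2 - q $ 2))\<^sup>2"
  let ?R = "Re ((cnj (p $ 2) * of_real (cmod (p $ 2) ^ (2 * m - 2))
      - cnj (q $ 2) * of_real (cmod (q $ 2) ^ (2 * m - 2))) * (p $ 2 - q $ 2))"
  have ER: "?E \<le> 2 * ?R" by (rule weighted_monotonicity)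
  moreover have "0 \<le> ?E" by simp
  ultimately have "0 \<le> ?R" by linarith
  then have "?R \<le> m * ?R" using assms mult_right_mono[of 1 "real m" ?R] by simp
  also have "\<dots> \<le> Re (egg_v m p q + egg_v m q p)"
    unfolding egg_v_symmetric_sum by simp
  also have "\<dots> \<le> egg_dist m p q"
    unfolding egg_dist_def plus_complex.sel by (intro add_mono complex_Re_le_cmod)
  finally show ?thesis using ER by linarith
qed

text \<open>The factor 8 is chosen so that 2r <= |w_0|^(2m) / 4; dividing by |w_0|^(2m-2) yields |w
  - w_0| <= |w_0| / 2.\<close>

lemma egg_dist_far:
  assumes m: "m \<ge> 1" and d: "egg_dist m p q < r" and r: "8 * r \<le> cmod (p $ 2) ^ (2 * m)" "0 < r"
  shows "cmod (p $ 2) / 2 \<le> cmod (q $ 2)" "cmod (q $ 2) \<le> 2 * cmod (p $ 2)"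
proof -
  let ?a = "cmod (p $ 2)" and ?N = "2 * m - 2"
  have a: "?a > 0" using r m by (auto simp: zero_less_power_eq power_0_left intro: ccontr)
  have "2 * m = ?N + 2" using m by simp
  then have pow: "?a ^ (2 * m) = ?a ^ ?N * ?a\<^sup>2" by (metis power_add)
  have "?a ^ ?N * (cmod (p $ 2 - q $ 2))\<^sup>2 \<le> 2 * egg_dist m p q"
    using egg_dist_snd[OF m, of p q] by (simp add: algebra_simps) (smt (verit) mult_nonneg_nonneg zero_le_power norm_ge_zero zero_le_power2)
  also have "\<dots> \<le> ?a ^ ?N * (?a / 2)\<^sup>2"
    using d r unfolding pow by (simp add: power_divide)
  finally have "(cmod (p $ 2 - q $ 2))\<^sup>2 \<le> (?a / 2)\<^sup>2" using a by simp
  then have "cmod (p $ 2 - q $ 2) \<le> ?a / 2" using a by (simp add: power2_le_iff_abs_le)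
  then show "?a / 2 \<le> cmod (q $ 2)" "cmod (q $ 2) \<le> 2 * ?a"
    using norm_triangle_ineq2[of "p $ 2" "q $ 2"] norm_triangle_ineq2[of "q $ 2" "p $ 2"] a
    by (auto simp: norm_minus_commute)
qed

lemma egg_boundary_le_1:
  assumes "m \<ge> 1" "p \<in> egg_boundary m"
  shows "cmod (p $ 1) \<le> 1" "cmod (p $ 2) \<le> 1"
proof -
  have sum: "(cmod (p $ 1))\<^sup>2 + cmod (p $ 2) ^ (2 * m) = 1"
    using assms by (simp add: egg_boundary_def)
  then have "(cmod (p $ 1))\<^sup>2 \<le> 1" by (smt (verit) norm_ge_zero zero_le_power)
  then show "cmod (p $ 1) \<le> 1" by (simp add: abs_square_le_1)
  have "cmod (p $ 2) ^ (2 * m) \<le> 1" using sum by (smt (verit) zero_le_power2)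
  then show "cmod (p $ 2) \<le> 1" using assms one_less_power[of "cmod (p $ 2)" "2 * m"] by linarith
qed

lemma egg_dist_near:
  assumes m: "m \<ge> 1" and pq: "p \<in> egg_boundary m" "q \<in> egg_boundary m"
    and d: "egg_dist m p q < r" and r: "cmod (p $ 2) ^ (2 * m) < 8 * r"
    and s: "0 < s" "s ^ (2 * m) = min r 1"
  shows "cmod (p $ 2) \<le> 8 * s" "cmod (q $ 2) \<le> 8 * s"
proof -
  let ?a = "cmod (p $ 2)" and ?b = "cmod (q $ 2)" and ?N = "2 * m - 2"
  have "2 * m = ?N + 2" using m by simp
  then have pow: "x ^ (2 * m) = x ^ ?N * x\<^sup>2" for x :: real by (metis power_add)
  have 64: "(8 * s) ^ (2 * m) = 64 ^ m * min r 1"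
    by (simp add: power_mult_distrib s(2)) (simp add: power_mult)
  \<comment> \<open>The factor 8 in front of s absorbs the loss 8 * 4^m <= 64^m. The 4^m pays for
    |w| <= 2 |w_0|; in the opposite case |w - w_0| >= |w| / 2 already gives |w|^(2m) <= 8r. For r >
    1 the bound follows from |w| <= 1.\<close>
  have le: "x \<le> 8 * s" if x: "x \<le> 1" "x ^ (2 * m) \<le> 8 * 4 ^ m * r" "0 \<le> x" for x
  proof -
    have "(4::real) ^ m * 8 \<le> 4 ^ m * 16 ^ m"
      using power_increasing[OF m, of "16::real"] by (intro mult_left_mono) auto
    also have "\<dots> = 64 ^ m" by (simp flip: power_mult_distrib)
    finally have c: "8 * 4 ^ m \<le> (64::real) ^ m" by (simp add: mult.commute)
    have r0: "r > 0" using s by (smt (verit) zero_less_power)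
    have "x ^ (2 * m) \<le> 64 ^ m * min r 1"
    proof (cases "r \<le> 1")
      case True
      have "x ^ (2 * m) \<le> 8 * 4 ^ m * r" by (rule x)
      also have "\<dots> \<le> 64 ^ m * r" using c r0 by (intro mult_right_mono) auto
      finally show ?thesis using True by simp
    next
      case False
      have "x ^ (2 * m) \<le> 1" using x by (intro power_le_one) auto
      also have "(1::real) \<le> 64 ^ m" by simp
      finally show ?thesis using False by simp
    qed
    then have "x ^ (2 * m) \<le> (8 * s) ^ (2 * m)" by (simp only: 64)
    moreover have "(8 * s) ^ (2 * m) < x ^ (2 * m)" if "8 * s < x"
      using that m s by (intro power_strict_mono) auto
    ultimately show ?thesis by linarith
  qed
  have r0: "r > 0" using s by (smt (verit) zero_less_power)
  have "8 * r \<le> 8 * 4 ^ m * r" using r0 by simp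
  then have a: "?a ^ (2 * m) \<le> 8 * 4 ^ m * r" using r by linarith
  then show "?a \<le> 8 * s" by (intro le egg_boundary_le_1[OF m pq(1)]) auto
  have "?b ^ (2 * m) \<le> 8 * 4 ^ m * r"
  proof (cases "?b \<le> 2 * ?a")
    case True
    then have "?b ^ (2 * m) \<le> (2 * ?a) ^ (2 * m)" by (intro power_mono) auto
    also have "\<dots> = 4 ^ m * ?a ^ (2 * m)" by (simp add: power_mult_distrib) (simp add: power_mult)
    also have "\<dots> \<le> 4 ^ m * (8 * r)" using r by (intro mult_left_mono) auto
    finally show ?thesis by simp
  next
    case False
    then have "?b / 2 \<le> cmod (p $ 2 - q $ 2)"
      using norm_triangle_ineq2[of "q $ 2" "p $ 2"] by (simp add: norm_minus_commute)
    then have "(?b / 2)\<^sup>2 \<le> (cmod (p $ 2 - q $ 2))\<^sup>2" by (intro power_mono) auto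
    then have "?b ^ ?N * (?b / 2)\<^sup>2 \<le> (?a ^ ?N + ?b ^ ?N) * (cmod (p $ 2 - q $ 2))\<^sup>2"
      by (intro mult_mono) auto
    also have "\<dots> \<le> 2 * r" using egg_dist_snd[OF m, of p q] d by linarith
    finally have "?b ^ (2 * m) \<le> 8 * r" unfolding pow by (simp add: power_divide)
    with \<open>8 * r \<le> 8 * 4 ^ m * r\<close> show ?thesis by linarith
  qed
  then show "?b \<le> 8 * s" by (intro le egg_boundary_le_1[OF m pq(2)]) auto
qed

lemma norm_egg_v_snd:
  assumes "m \<ge> 1"
  shows "cmod (of_nat m * cnj (p $ 2) * of_real (cmod (p $ 2) ^ (2 * m - 2)) * (p $ 2 - q $ 2)) =
    m * cmod (p $ 2) ^ (2 * m - 1) * cmod (p $ 2 - q $ 2)"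
proof -
  have "2 * m - 1 = Suc (2 * m - 2)" using assms by simp
  then show ?thesis by (simp add: norm_mult norm_power)
qed

text \<open>By the identity \<open>*\<close> the squared distance is (a - b)^2 plus a b times the
  squared chord, and a b >= 1/4.\<close>

lemma polar_diff_ge:
  assumes "a \<ge> 1/2" "b \<ge> 1/2"
  shows "cmod (cis s - cis t) \<le> 2 * cmod (of_real a * cis s - of_real b * cis t)"
proof -
  have *: "(cmod (of_real a * cis s - of_real b * cis t))\<^sup>2 =
      (a - b)\<^sup>2 + a * b * (cmod (cis s - cis t))\<^sup>2" for a b :: real
  proof -
    have "(cos s)\<^sup>2 + (sin s)\<^sup>2 = 1" "(cos t)\<^sup>2 + (sin t)\<^sup>2 = 1" by auto
    then have "(a * cos s - b * cos t)\<^sup>2 + (a * sin s - b * sin t)\<^sup>2 =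
        (a - b)\<^sup>2 + a * b * ((cos s - cos t)\<^sup>2 + (sin s - sin t)\<^sup>2)"
      by algebra
    then show ?thesis by (simp add: cmod_power2)
  qed
  have "1/2 * (1/2) \<le> a * b" using assms by (intro mult_mono) auto
  then have "1/4 * (cmod (cis s - cis t))\<^sup>2 \<le> a * b * (cmod (cis s - cis t))\<^sup>2"
    by (intro mult_right_mono) auto
  also have "\<dots> \<le> (cmod (of_real a * cis s - of_real b * cis t))\<^sup>2" unfolding * by simp
  finally have "(cmod (cis s - cis t))\<^sup>2 \<le> (2 * cmod (of_real a * cis s - of_real b * cis t))\<^sup>2"
    by (simp add: power_mult_distrib)
  then show ?thesis by (rule power2_le_imp_le) simp
qed

lemma angle_near:
  assumes "\<bar>a\<bar> \<le> pi" "\<bar>b\<bar> \<le> pi"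
  shows "\<exists>k\<in>{-1, 0, 1}. \<bar>a - b - 2 * pi * k\<bar> \<le> pi"
proof -
  have "\<bar>a - b\<bar> \<le> pi \<or> \<bar>a - b - 2 * pi\<bar> \<le> pi \<or> \<bar>a - b + 2 * pi\<bar> \<le> pi"
    using assms by (auto simp: abs_if split: if_splits)
  then show ?thesis by auto
qed

text \<open>Principal arguments are comparable only modulo 2 pi, hence the shift \<open>k\<close>.
  From v one gets |z_0| |z - z_0| <= C min(r, 1) with C = 1 + 2m 64^m. This controls the angle if
  64^m min(r, 1) <= 3/4, for then |z|^2 and |z_0|^2 are at least 1/4. Otherwise the claimed bound is
  at least pi and holds trivially.\<close>

lemma egg_dist_angle:
  assumes m: "m \<ge> 1" and pq: "p \<in> egg_boundary m" "q \<in> egg_boundary m"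
    and d: "egg_dist m p q < r" and near: "cmod (p $ 2) \<le> 8 * s" "cmod (q $ 2) \<le> 8 * s"
    and s: "0 < s" "s ^ (2 * m) = min r 1"
  shows "\<exists>k\<in>{-1, 0, 1}. \<bar>Arg (q $ 1) - Arg (p $ 1) - 2 * pi * k\<bar> \<le> 2 * pi * (1 + 2 * m * 64 ^ m) * min r 1"
proof -
  define C where "C = 1 + 2 * real m * 64 ^ m"
  define r' where "r' = min r 1"
  have r': "0 < r'" unfolding r'_def using s by (metis zero_less_power)
  have 64: "(8 * s) ^ (2 * m) = 64 ^ m * r'"
    by (simp add: power_mult_distrib s(2) r'_def) (simp add: power_mult)
  have absArg: "\<bar>Arg z\<bar> \<le> pi" for z
    using mpi_less_Arg[of z] Arg_le_pi[of z] by auto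
  obtain k where k: "k \<in> {-1, 0, 1}" "\<bar>Arg (q $ 1) - Arg (p $ 1) - 2 * pi * k\<bar> \<le> pi"
    using angle_near[OF absArg absArg] by blast
  define x where "x = Arg (p $ 1) + 2 * pi * k"
  have x: "\<bar>Arg (q $ 1) - x\<bar> \<le> pi" using k by (simp add: x_def algebra_simps)
  have cisx: "cis x = cis (Arg (p $ 1))"
    using k(1) by (auto simp: x_def simp flip: cis_mult cis_divide cis_cnj)
  have "\<bar>Arg (q $ 1) - x\<bar> \<le> 2 * pi * C * r'"
  proof (cases "64 ^ m * r' \<le> 3/4")
    case True
    have "(1::real) \<le> 64 ^ m" by simp
    then have "1 * r' \<le> 64 ^ m * r'" using r' by (intro mult_right_mono) auto
    then have rr: "r' = r" using True by (simp add: r'_def min_def split: if_splits)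
    have half: "1/2 \<le> cmod (y $ 1)" if y: "y \<in> egg_boundary m" "cmod (y $ 2) \<le> 8 * s" for y
    proof -
      have "cmod (y $ 2) ^ (2 * m) \<le> (8 * s) ^ (2 * m)" using y by (intro power_mono) auto
      then have "(1/2)\<^sup>2 \<le> (cmod (y $ 1))\<^sup>2"
        using y True 64 by (simp add: egg_boundary_def power2_eq_square)
      then show ?thesis by (rule power2_le_imp_le) simp
    qed
    have "2 * m = Suc (2 * m - 1)" using m by simp
    then have pow: "(8 * s) ^ (2 * m) = (8 * s) ^ (2 * m - 1) * (8 * s)" by (metis power_Suc2)
    have "cmod (p $ 1) * cmod (p $ 1 - q $ 1) = cmod (egg_v m p q -
      of_nat m * cnj (p $ 2) * of_real (cmod (p $ 2) ^ (2 * m - 2)) * (p $ 2 - q $ 2))"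
      by (simp add: egg_v_def norm_mult)
    also have "\<dots> \<le> cmod (egg_v m p q) + m * cmod (p $ 2) ^ (2 * m - 1) * cmod (p $ 2 - q $ 2)"
      using norm_triangle_ineq4 norm_egg_v_snd[OF m] by metis
    also have "\<dots> \<le> r + m * (8 * s) ^ (2 * m - 1) * (8 * s + 8 * s)"
    proof (intro add_mono mult_mono power_mono)
      show "cmod (egg_v m p q) \<le> r" using d norm_ge_zero[of "egg_v m q p"] unfolding egg_dist_def by linarith
      show "cmod (p $ 2 - q $ 2) \<le> 8 * s + 8 * s"
        using near norm_triangle_ineq4[of "p $ 2" "q $ 2"] by linarith
    qed (use near s in auto)
    also have "\<dots> = r + 2 * m * (8 * s) ^ (2 * m)" unfolding pow by simp
    also have "\<dots> = C * r'" unfolding 64 C_def rr by (simp add: algebra_simps)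
    finally have *: "cmod (p $ 1) * cmod (p $ 1 - q $ 1) \<le> C * r'" .
    have "1/2 * cmod (p $ 1 - q $ 1) \<le> C * r'"
      using * half[OF pq(1) near(1)] mult_right_mono[of "1/2" "cmod (p $ 1)" "cmod (p $ 1 - q $ 1)"] by auto
    have "2 / pi * \<bar>Arg (q $ 1) - x\<bar> \<le> cmod (cis (Arg (q $ 1)) - cis x)"
      by (rule norm_cis_diff_ge[OF x])
    also have "\<dots> \<le> 2 * cmod (q $ 1 - p $ 1)"
      unfolding cisx
      using polar_diff_ge[OF half[OF pq(2) near(2)] half[OF pq(1) near(1)], of "Arg (q $ 1)" "Arg (p $ 1)"]
      by (simp add: rcis_cmod_Arg[unfolded rcis_def])
    also have "\<dots> \<le> 4 * (C * r')"
      using \<open>1/2 * cmod (p $ 1 - q $ 1) \<le> C * r'\<close> by (simp add: norm_minus_commute)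
    finally show ?thesis by (simp add: field_simps)
  next
    case False
    have "1 * (64 ^ m * r') \<le> (2 * real m) * (64 ^ m * r')" using m r' by (intro mult_right_mono) auto
    moreover have "C * r' = r' + 2 * real m * (64 ^ m * r')" by (simp add: C_def algebra_simps)
    ultimately have "1 \<le> 2 * (C * r')" using False r' by linarith
    then have "pi * 1 \<le> pi * (2 * (C * r'))" by (intro mult_left_mono) auto
    moreover have "pi * (2 * (C * r')) = 2 * pi * C * r'" by simp
    ultimately show ?thesis using x by linarith
  qed
  then show ?thesis
    using k(1) by (intro bexI[of _ k]) (simp_all add: x_def C_def r'_def algebra_simps)
qed

text \<open>The difference of z splits into a radial and an angular part. The radial part alone is
  not Lipschitz in w near z = 0, but v carries the factor |z|, and |z| times it is at most the
  difference of the |z|^2, which the boundary equation turns into that of the |w|^(2m). This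
  contributes 2m M^(2m-1), the w-term of v another m M^(2m-1); two terms v make 6m.\<close>

lemma egg_dist_upper:
  assumes m: "m \<ge> 1" and pq: "p \<in> egg_boundary m" "q \<in> egg_boundary m"
    and M: "cmod (p $ 2) \<le> M" "cmod (q $ 2) \<le> M"
  shows "egg_dist m p q \<le> 2 * \<bar>Arg (p $ 1) - Arg (q $ 1)\<bar> + 6 * real m * M ^ (2 * m - 1) * cmod (p $ 2 - q $ 2)"
proof -
  have M0: "M \<ge> 0" using M norm_ge_zero order_trans by blast
  have v: "cmod (egg_v m p q) \<le> \<bar>Arg (p $ 1) - Arg (q $ 1)\<bar> + 3 * (m * M ^ (2 * m - 1) * cmod (p $ 2 - q $ 2))"
    if pq: "p \<in> egg_boundary m" "q \<in> egg_boundary m" and M: "cmod (p $ 2) \<le> M" "cmod (q $ 2) \<le> M" for p q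
  proof -
    let ?K = "m * M ^ (2 * m - 1) * cmod (p $ 2 - q $ 2)"
    let ?a = "cmod (p $ 1)" and ?b = "cmod (q $ 1)"
    have "p $ 1 - q $ 1 = of_real (?a - ?b) * cis (Arg (p $ 1)) + of_real ?b * (cis (Arg (p $ 1)) - cis (Arg (q $ 1)))"
    proof -
      show ?thesis
        using rcis_cmod_Arg[of "p $ 1"] rcis_cmod_Arg[of "q $ 1"] by (simp add: rcis_def algebra_simps)
    qed
    then have "cmod (p $ 1 - q $ 1) \<le> \<bar>?a - ?b\<bar> + ?b * cmod (cis (Arg (p $ 1)) - cis (Arg (q $ 1)))"
      by (metis (no_types, lifting) abs_norm_cancel mult.right_neutral norm_cis norm_mult norm_of_real norm_triangle_ineq)
    also have "\<dots> \<le> \<bar>?a - ?b\<bar> + 1 * \<bar>Arg (p $ 1) - Arg (q $ 1)\<bar>"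
      using egg_boundary_le_1[OF m pq(2)] norm_cis_diff_le by (intro add_mono mult_mono) auto
    finally have "?a * cmod (p $ 1 - q $ 1) \<le> ?a * (\<bar>?a - ?b\<bar> + \<bar>Arg (p $ 1) - Arg (q $ 1)\<bar>)"
      by (intro mult_left_mono) auto
    also have "\<dots> \<le> (?a + ?b) * \<bar>?a - ?b\<bar> + 1 * \<bar>Arg (p $ 1) - Arg (q $ 1)\<bar>"
      unfolding distrib_left using egg_boundary_le_1[OF m pq(1)] by (intro add_mono mult_right_mono) auto
    also have "(?a + ?b) * \<bar>?a - ?b\<bar> = \<bar>?a\<^sup>2 - ?b\<^sup>2\<bar>"
      by (simp add: square_diff_square_factored power2_eq_square abs_mult)
    also have "?a\<^sup>2 - ?b\<^sup>2 = cmod (q $ 2) ^ (2 * m) - cmod (p $ 2) ^ (2 * m)"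
      using pq unfolding egg_boundary_def mem_Collect_eq by linarith
    also have "\<bar>cmod (q $ 2) ^ (2 * m) - cmod (p $ 2) ^ (2 * m)\<bar> \<le> real (2 * m) * M ^ (2 * m - 1) * \<bar>cmod (q $ 2) - cmod (p $ 2)\<bar>"
      using M by (intro abs_power_diff_le) auto
    also have "\<dots> \<le> real (2 * m) * M ^ (2 * m - 1) * cmod (p $ 2 - q $ 2)"
      using norm_triangle_ineq3[of "q $ 2" "p $ 2"] M0
      by (intro mult_left_mono) (auto simp: norm_minus_commute)
    finally have 1: "?a * cmod (p $ 1 - q $ 1) \<le> 2 * ?K + \<bar>Arg (p $ 1) - Arg (q $ 1)\<bar>" by simp
    have 2: "cmod (egg_v m p q) \<le> ?a * cmod (p $ 1 - q $ 1) + m * cmod (p $ 2) ^ (2 * m - 1) * cmod (p $ 2 - q $ 2)"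
    proof -
      have "cmod (cnj (p $ 1) * (p $ 1 - q $ 1)) = ?a * cmod (p $ 1 - q $ 1)"
        by (simp add: norm_mult)
      then show ?thesis
        unfolding egg_v_def using norm_triangle_ineq norm_egg_v_snd[OF m, of p q] by metis
    qed
    have 3: "m * cmod (p $ 2) ^ (2 * m - 1) * cmod (p $ 2 - q $ 2) \<le> ?K"
      using M by (intro mult_right_mono mult_left_mono power_mono) auto
    show ?thesis using order_trans[OF 2 add_mono[OF 1 3]] by (simp add: algebra_simps)
  qed
  show ?thesis
    unfolding egg_dist_def
    using v[OF pq M] v[OF pq(2,1) M(2,1)]
    by (simp add: norm_minus_commute abs_minus_commute)
qed

section \<open>The weight and the volume of balls\<close>

lemma emeasure_lborel_3:
  fixes a b :: "real ^ 3"
  assumes "a $ 1 \<le> b $ 1" "a $ 2 \<le> b $ 2" "a $ 3 \<le> b $ 3"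
  shows "emeasure lborel (box a b) = ennreal ((b $ 1 - a $ 1) * (b $ 2 - a $ 2) * (b $ 3 - a $ 3))"
    and "emeasure lborel (cbox a b) = ennreal ((b $ 1 - a $ 1) * (b $ 2 - a $ 2) * (b $ 3 - a $ 3))"
proof -
  have le: "a \<bullet> i \<le> b \<bullet> i" if i: "i \<in> Basis" for i
  proof -
    obtain k :: 3 where "i = axis k 1" using i by (auto simp: Basis_vec_def)
    then show ?thesis using assms exhaust_3[of k] by (auto simp: inner_axis)
  qed
  have ne: "cbox a b \<noteq> {}" using le by (simp add: box_ne_empty)
  have "measure lborel (cbox a b) = (b $ 1 - a $ 1) * (b $ 2 - a $ 2) * (b $ 3 - a $ 3)"
    using content_cbox_cart[OF ne] by (simp only: UNIV_3) simp
  moreover have "emeasure lborel (cbox a b) \<noteq> top"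
    by (metis emeasure_lborel_cbox_finite infinity_ennreal_def order_less_irrefl)
  ultimately show cb: "emeasure lborel (cbox a b) = ennreal ((b $ 1 - a $ 1) * (b $ 2 - a $ 2) * (b $ 3 - a $ 3))"
    by (simp add: emeasure_eq_ennreal_measure)
  have "emeasure lborel (box a b) = emeasure lborel (cbox a b)"
    using le by (simp add: emeasure_lborel_box emeasure_lborel_cbox)
  with cb show "emeasure lborel (box a b) = ennreal ((b $ 1 - a $ 1) * (b $ 2 - a $ 2) * (b $ 3 - a $ 3))"
    by simp
qed

lemma ennreal_average_product_le:
  fixes V I J :: ennreal
  assumes V: "0 < V" "V < \<infinity>" and IJ: "I \<le> ennreal a * V" "J \<le> ennreal b * V" and a: "0 \<le> a"
  shows "I / V * (J / V) \<le> ennreal (a * b)"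
proof -
  have "x / V \<le> ennreal c" if "x \<le> ennreal c * V" for x c
  proof -
    have "x / V \<le> ennreal c * V / V" using that by (rule divide_right_mono_ennreal)
    also have "\<dots> = ennreal c" using V by (intro ennreal_mult_divide_eq) auto
    finally show ?thesis .
  qed
  then have "I / V * (J / V) \<le> ennreal a * ennreal b" using IJ by (intro mult_mono) auto
  then show ?thesis using a by (simp add: ennreal_mult')
qed

lemma continuous_on_egg_dist: "continuous_on S (egg_dist m p)"
  unfolding egg_dist_def egg_v_def by (intro continuous_intros)

lemma borel_egg_ball: "qball (egg_boundary m) (egg_dist m) p r \<in> sets borel"
proof -
  have "closed (egg_boundary m)" by (rule closed_egg_boundary)
  moreover have "open {y. egg_dist m p y < r}"
    by (intro open_Collect_less continuous_on_egg_dist continuous_on_const)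
  moreover have "qball (egg_boundary m) (egg_dist m) p r = egg_boundary m \<inter> {y. egg_dist m p y < r}"
    by (auto simp: qball_def)
  ultimately show ?thesis by auto
qed

lemma egg_hess_nonneg: "0 \<le> egg_hess m p"
  by (simp add: egg_hess_def)

text \<open>The expression \<open>D\<close> under the root lies between 1/4 and 4 m^2. For the lower
  bound: if W >= 1/2, then the Hessian factor is at least W and their product at least 1/4;
  otherwise |z|^2 > 1/2.\<close>

lemma fefferman_weight_bounds:
  assumes m: "m \<ge> 1" and p: "p \<in> egg_boundary m"
  shows "egg_hess m p powr (1/3) / (2 * m) \<le> fefferman_weight (egg_rho m) p"
    and "fefferman_weight (egg_rho m) p \<le> 2 * egg_hess m p powr (1/3)"
proof -
  define W where "W = cmod (p $ 2) ^ (2 * m)"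
  define D where "D = (cmod (p $ 1))\<^sup>2 + egg_hess m p * W"
  have sum: "(cmod (p $ 1))\<^sup>2 + W = 1" using p by (simp add: egg_boundary_def W_def)
  have w: "cmod (p $ 2) \<le> 1" by (rule egg_boundary_le_1[OF m p])
  have m1: "1 \<le> (real m)\<^sup>2" using m by simp
  have W0: "0 \<le> W" by (simp add: W_def)
  then have W1: "W \<le> 1" using sum zero_le_power2[of "cmod (p $ 1)"] by linarith
  have WN: "W \<le> cmod (p $ 2) ^ (2 * m - 2)"
    unfolding W_def using w by (intro power_decreasing) auto
  have "egg_hess m p \<le> (real m)\<^sup>2 * 1"
    unfolding egg_hess_def using w by (intro mult_left_mono power_le_one) auto
  then have "egg_hess m p * W \<le> (real m)\<^sup>2 * 1 * 1" using W0 W1 by (intro mult_mono) auto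
  moreover have "(cmod (p $ 1))\<^sup>2 \<le> 1" using sum W0 by linarith
  ultimately have "D \<le> (2 * real m)\<^sup>2" unfolding D_def using m1 by (simp add: power_mult_distrib)
  then have up: "sqrt D \<le> 2 * m" by (simp add: real_le_lsqrt)
  have "(1/2)\<^sup>2 \<le> D"
  proof (cases "W \<ge> 1/2")
    case True
    have "1/2 * (1/2) \<le> egg_hess m p * W"
    proof (rule mult_mono)
      have "1 * W \<le> egg_hess m p"
        unfolding egg_hess_def using m1 WN W0 by (intro mult_mono) auto
      then show "1/2 \<le> egg_hess m p" using True by linarith
    qed (use True in \<open>auto simp: egg_hess_nonneg\<close>)
    then show ?thesis
      using zero_le_power2[of "cmod (p $ 1)"] unfolding D_def power2_eq_square[of "1/2"] by linarith
  next
    case False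
    have "0 \<le> egg_hess m p * W" using W0 by (simp add: egg_hess_nonneg)
    then show ?thesis using False sum unfolding D_def power2_eq_square[of "1/2"] by linarith
  qed
  then have lo: "1/2 \<le> sqrt D" by (rule real_le_rsqrt)
  then have pos: "0 < sqrt D" by linarith
  have eq: "fefferman_weight (egg_rho m) p = egg_hess m p powr (1/3) / sqrt D"
    unfolding fefferman_weight_egg[OF m p] D_def W_def ..
  show "egg_hess m p powr (1/3) / (2 * m) \<le> fefferman_weight (egg_rho m) p"
    unfolding eq using up pos order_less_le_trans[OF pos up]
    by (intro divide_left_mono mult_pos_pos) auto
  have "egg_hess m p powr (1/3) / sqrt D \<le> egg_hess m p powr (1/3) / (1/2)"
    using lo pos by (intro divide_left_mono mult_pos_pos) auto
  then show "fefferman_weight (egg_rho m) p \<le> 2 * egg_hess m p powr (1/3)"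
    unfolding eq by simp
qed

lemma borel_measurable_fefferman_weight:
  assumes m: "m \<ge> 1"
  shows "fefferman_weight (egg_rho m) \<in> borel_measurable (egg_model m)"
proof -
  have "continuous_on UNIV (egg_hess m)"
    unfolding egg_hess_def by (intro continuous_intros)
  then have [measurable]: "egg_hess m \<in> borel_measurable borel"
    by (rule borel_measurable_continuous_onI)
  have "continuous_on UNIV (\<lambda>p :: complex ^ 2. (cmod (p $ 1))\<^sup>2)" "continuous_on UNIV (\<lambda>p :: complex ^ 2. cmod (p $ 2) ^ (2 * m))"
    by (intro continuous_intros)+
  then have [measurable]: "(\<lambda>p :: complex ^ 2. (cmod (p $ 1))\<^sup>2) \<in> borel_measurable borel"
    "(\<lambda>p :: complex ^ 2. cmod (p $ 2) ^ (2 * m)) \<in> borel_measurable borel"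
    by (auto intro: borel_measurable_continuous_onI)
  have "(\<lambda>p. egg_hess m p powr (1/3) / sqrt ((cmod (p $ 1))\<^sup>2 + egg_hess m p * cmod (p $ 2) ^ (2 * m)))
    \<in> borel_measurable borel"
    by measurable
  then have "(\<lambda>p. egg_hess m p powr (1/3) / sqrt ((cmod (p $ 1))\<^sup>2 + egg_hess m p * cmod (p $ 2) ^ (2 * m)))
    \<in> borel_measurable (egg_model m)"
    by (simp add: measurable_restrict_space1 measurable_cong_sets[OF sets_egg_model refl])
  then show ?thesis
    by (subst measurable_cong[OF fefferman_weight_egg[OF m]]) (auto simp: space_egg_model)
qed

lemma egg_param_snd: "egg_param m u $ 2 = Complex (u $ 1) (u $ 2)"
  by (simp add: egg_param_def)

lemma Arg_egg_param:
  assumes "m \<ge> 1" "u \<in> egg_box"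
  shows "Arg (egg_param m u $ 1) = u $ 3"
proof -
  have "egg_coord (egg_param m u) $ 3 = u $ 3"
    by (simp only: egg_coord_param[OF assms])
  then show ?thesis by (simp only: egg_coord_def vector_3)
qed

section \<open>Size of the balls that come close to w = 0\<close>

text \<open>The ball lies in three boxes, one for each shift of the angle by a multiple of 2 pi; 16
  s is the width of the square around |w| <= 8 s and \<open>h\<close> the angular bound of
  \<open>egg_dist_angle\<close>.\<close>

lemma egg_ball_volume_upper:
  assumes m: "m \<ge> 1" and p: "p \<in> egg_boundary m"
    and near: "cmod (p $ 2) \<le> 8 * s" "\<And>q. q \<in> qball (egg_boundary m) (egg_dist m) p r \<Longrightarrow> cmod (q $ 2) \<le> 8 * s"
    and s: "0 < s" "s ^ (2 * m) = min r 1"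
  defines "h \<equiv> 2 * pi * (1 + 2 * m * 64 ^ m) * min r 1"
  shows "emeasure lborel (egg_box \<inter> egg_param m -` qball (egg_boundary m) (egg_dist m) p r)
    \<le> ennreal (3 * ((16 * s)\<^sup>2 * (2 * h)))"
proof -
  have "min r 1 > 0" using s by (metis zero_less_power)
  then have h: "h > 0" by (simp add: h_def add_pos_nonneg)
  define \<theta> where "\<theta> = Arg (p $ 1)"
  define Q where "Q k = cbox (vector [- 8 * s, - 8 * s, \<theta> + 2 * pi * k - h] :: real ^ 3)
    (vector [8 * s, 8 * s, \<theta> + 2 * pi * k + h])" for k
  have "egg_box \<inter> egg_param m -` qball (egg_boundary m) (egg_dist m) p r \<subseteq> (\<Union>k\<in>{-1, 0, 1}. Q k)"
  proof
    fix u assume "u \<in> egg_box \<inter> egg_param m -` qball (egg_boundary m) (egg_dist m) p r"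
    then have u: "u \<in> egg_box" and q: "egg_param m u \<in> qball (egg_boundary m) (egg_dist m) p r" by auto
    have "cmod (egg_param m u $ 2) \<le> 8 * s" by (rule near(2)[OF q])
    then have 12: "\<bar>u $ 1\<bar> \<le> 8 * s" "\<bar>u $ 2\<bar> \<le> 8 * s"
      using abs_Re_le_cmod[of "egg_param m u $ 2"] abs_Im_le_cmod[of "egg_param m u $ 2"]
      by (auto simp: egg_param_snd)
    obtain k where k: "k \<in> {-1, 0, 1}" "\<bar>Arg (egg_param m u $ 1) - \<theta> - 2 * pi * k\<bar> \<le> h"
      using egg_dist_angle[OF m p, of "egg_param m u" r s] near(2)[OF q] near(1) q s
      unfolding h_def \<theta>_def qball_def by blast
    then have "\<bar>u $ 3 - \<theta> - 2 * pi * k\<bar> \<le> h" by (simp add: Arg_egg_param[OF m u])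
    then have "u \<in> Q k" using 12 by (auto simp: Q_def mem_box_cart forall_3)
    then show "u \<in> (\<Union>k\<in>{-1, 0, 1}. Q k)" using k by blast
  qed
  then have "emeasure lborel (egg_box \<inter> egg_param m -` qball (egg_boundary m) (egg_dist m) p r)
      \<le> emeasure lborel (\<Union>k\<in>{-1, 0, 1}. Q k)"
    by (rule emeasure_mono) (auto simp: Q_def)
  also have "\<dots> \<le> (\<Sum>k\<in>{-1, 0, 1}. emeasure lborel (Q k))"
    by (rule emeasure_subadditive_finite) (auto simp: Q_def)
  also have "\<dots> = (\<Sum>k\<in>{-1, 0, 1 :: real}. ennreal ((16 * s)\<^sup>2 * (2 * h)))"
  proof (rule sum.cong[OF refl])
    fix k :: real
    show "emeasure lborel (Q k) = ennreal ((16 * s)\<^sup>2 * (2 * h))"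
      unfolding Q_def by (subst emeasure_lborel_3) (use s h in \<open>auto simp: power2_eq_square\<close>)
  qed
  also have "\<dots> = ennreal (3 * ((16 * s)\<^sup>2 * (2 * h)))"
    using h by (simp add: ennreal_mult' numeral_mult_ennreal)
  finally show ?thesis .
qed

text \<open>The bound is the volume of an explicit box inside the ball times the least density
  there. The value of \<open>t\<close> makes the w-part of \<open>egg_dist_upper\<close> equal to
  min(r, 1) / 40, where 100^m stems from (10 s)^(2m); the angle contributes at most 2
  \<open>e\<close> = min(r, 1) / 4.\<close>

lemma egg_model_ball_lower:
  assumes m: "m \<ge> 1" and p: "p \<in> egg_boundary m"
    and near: "cmod (p $ 2) \<le> 8 * s" and s: "0 < s" "s ^ (2 * m) = min r 1"
  defines "t \<equiv> s / (48 * m * 100 ^ m)"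
  shows "ennreal ((real m)\<^sup>2 * (t / 4) ^ (2 * m - 2) / (2 * pi\<^sup>2) * ((t / 4)\<^sup>2 * (min r 1 / 8)))
    \<le> emeasure (egg_model m) (qball (egg_boundary m) (egg_dist m) p r)"
proof -
  define e where "e = min r 1 / 8"
  define w where "w = p $ 2"
  define \<theta> where "\<theta> = Arg (p $ 1)"
  \<comment> \<open>The interval from f x to f x + t/4 lies on the far side of x from 0: its points
    have modulus at least t/4, which keeps the density away from 0, and are within t/2 of x.\<close>
  define f where "f x = (if x \<ge> 0 then x + t / 4 else x - t / 2)" for x :: real
  \<comment> \<open>The angular interval lies on the side of theta that points towards 0, so it
    stays within (-pi, pi) even if theta = pi.\<close>
  define g where "g = (if \<theta> > 0 then \<theta> - e else \<theta>)"
  \<comment> \<open>Moving w_0 inwards by the factor 1 - t leaves room for a displacement below t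
    within the unit disc.\<close>
  define c where "c = (1 - t) *\<^sub>R w"
  define Q where "Q = box (vector [f (Re c), f (Im c), g] :: real ^ 3)
    (vector [f (Re c) + t / 4, f (Im c) + t / 4, g + e])"
  define b where "b = (real m)\<^sup>2 * (t / 4) ^ (2 * m - 2) / (2 * pi\<^sup>2)"
  let ?B = "qball (egg_boundary m) (egg_dist m) p r"
  have r: "min r 1 > 0" using s by (metis zero_less_power)
  then have e: "0 < e" "e < pi" using pi_ge_two by (auto simp: e_def)
  have s1: "s \<le> 1"
  proof (rule ccontr)
    assume "\<not> s \<le> 1"
    then have "1 < s ^ (2 * m)" using m by (intro one_less_power) auto
    then show False using s(2) by simp
  qed
  have "(1::real) \<le> 100 ^ m" by simp
  then have "1 * 1 \<le> real m * 100 ^ m" using m by (intro mult_mono) auto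
  then have K: "1 \<le> 48 * real m * 100 ^ m" by linarith
  have ts: "0 < t" "t \<le> s" using K s m by (auto simp: t_def divide_le_eq)
  have w1: "cmod w \<le> 1" unfolding w_def by (rule egg_boundary_le_1[OF m p])
  have f: "t / 4 \<le> \<bar>y\<bar>" "\<bar>y - x\<bar> < t / 2" if "f x < y" "y < f x + t / 4" for x y
    using that ts by (auto simp: f_def split: if_splits)
  have g: "\<bar>y - \<theta>\<bar> < e" "- pi < y" "y < pi" if "g < y" "y < g + e" for y
    using that e mpi_less_Arg[of "p $ 1"] Arg_le_pi[of "p $ 1"]
    by (auto simp: g_def \<theta>_def split: if_splits)
  have Q: "u \<in> egg_box" "egg_param m u \<in> ?B" "b \<le> egg_density m u" if "u \<in> Q" for u
  proof -
    have u: "f (Re c) < u $ 1" "u $ 1 < f (Re c) + t / 4" "f (Im c) < u $ 2" "u $ 2 < f (Im c) + t / 4"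
      "g < u $ 3" "u $ 3 < g + e"
      using that by (auto simp: Q_def mem_box_cart forall_3)
    define W where "W = Complex (u $ 1) (u $ 2)"
    have "cmod (W - c) \<le> \<bar>Re (W - c)\<bar> + \<bar>Im (W - c)\<bar>" by (rule cmod_le)
    also have "\<dots> < t" using f(2)[OF u(1,2)] f(2)[OF u(3,4)] by (simp add: W_def)
    finally have Wc: "cmod (W - c) < t" .
    have "cmod c \<le> 1 - t" using ts s1 w1 mult_left_mono[OF w1, of "1 - t"] by (simp add: c_def)
    then have W1: "cmod W < 1" using Wc norm_triangle_sub[of W c] by linarith
    show box: "u \<in> egg_box" using W1 g(2,3)[OF u(5,6)] by (simp add: egg_box_def W_def)
    have "c - w = - (t *\<^sub>R w)" by (simp add: c_def algebra_simps)
    then have "cmod (c - w) \<le> t" using ts w1 mult_left_mono[OF w1, of t] by simp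
    then have Ww: "cmod (W - w) < 2 * t" using Wc norm_triangle_ineq[of "W - c" "c - w"] by simp
    let ?q = "egg_param m u"
    have q2: "?q $ 2 = W" by (simp add: egg_param_snd W_def)
    have qM: "?q \<in> egg_boundary m" by (rule egg_param_in_boundary[OF m box])
    have "egg_dist m p ?q \<le> 2 * \<bar>Arg (p $ 1) - Arg (?q $ 1)\<bar> + 6 * real m * (10 * s) ^ (2 * m - 1) * cmod (p $ 2 - ?q $ 2)"
    proof (rule egg_dist_upper[OF m p qM])
      show "cmod (p $ 2) \<le> 10 * s" using near s by linarith
      show "cmod (?q $ 2) \<le> 10 * s"
        unfolding q2 using Ww near ts norm_triangle_sub[of W w] by (simp add: w_def)
    qed
    also have "\<dots> \<le> 2 * e + 6 * real m * (10 * s) ^ (2 * m - 1) * (2 * t)"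
      using g(1)[OF u(5,6)] Ww s
      by (intro add_mono mult_left_mono)
         (auto simp: Arg_egg_param[OF m box] \<theta>_def q2 w_def norm_minus_commute abs_minus_commute)
    also have "6 * real m * (10 * s) ^ (2 * m - 1) * (2 * t) = min r 1 / 40"
    proof -
      have "2 * m = Suc (2 * m - 1)" using m by simp
      then have "(10 * s) ^ (2 * m) = (10 * s) ^ (2 * m - 1) * (10 * s)" by (metis power_Suc2)
      moreover have "(10 * s) ^ (2 * m) = 100 ^ m * min r 1"
        by (simp add: power_mult_distrib s(2)) (simp add: power_mult)
      ultimately have *: "(10 * s) ^ (2 * m - 1) * s = 100 ^ m * min r 1 / 10" by simp
      have "6 * real m * (10 * s) ^ (2 * m - 1) * (2 * t) = (12 * m / (48 * m * 100 ^ m)) * ((10 * s) ^ (2 * m - 1) * s)"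
        by (simp add: t_def)
      also have "\<dots> = min r 1 / 40" unfolding * using m by simp
      finally show ?thesis .
    qed
    also have "2 * e + min r 1 / 40 < r" using r by (auto simp: e_def min_def split: if_splits)
    finally show "?q \<in> ?B" using qM by (simp add: qball_def)
    have "t / 4 \<le> \<bar>Re W\<bar>" using f(1)[OF u(1,2)] by (simp add: W_def)
    then have "t / 4 \<le> cmod W" using abs_Re_le_cmod[of W] by linarith
    then show "b \<le> egg_density m u"
      unfolding b_def egg_density_def W_def[symmetric] using ts
      by (intro divide_right_mono mult_left_mono power_mono) auto
  qed
  have b: "0 \<le> b" using ts by (simp add: b_def)
  have "ennreal (b * ((t / 4)\<^sup>2 * e)) = ennreal b * emeasure lborel Q"
    unfolding Q_def using ts e b
    by (subst emeasure_lborel_3) (auto simp: power2_eq_square simp flip: ennreal_mult')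
  also have "\<dots> = (\<integral>\<^sup>+u\<in>Q. ennreal b \<partial>lborel)"
    by (subst nn_integral_cmult_indicator) (auto simp: Q_def)
  also have "\<dots> \<le> (\<integral>\<^sup>+u\<in>egg_box \<inter> egg_param m -` ?B. ennreal (egg_density m u) \<partial>lborel)"
    using Q by (intro nn_integral_mono) (auto simp: indicator_def intro!: ennreal_leI)
  also have "\<dots> = emeasure (egg_model m) ?B"
    by (rule emeasure_egg_model[OF m borel_egg_ball, symmetric]) (auto simp: qball_def)
  finally show ?thesis unfolding b_def e_def .
qed

section \<open>The two kinds of balls\<close>

lemma egg_model_finite:
  assumes m: "m \<ge> 1"
  shows "finite_measure (egg_model m)"
proof
  have "(\<integral>\<^sup>+u\<in>egg_box. ennreal (egg_density m u) \<partial>lborel) = ennreal (integral egg_box (egg_density m))"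
    using set_lebesgue_integral_eq_integral(1)[OF egg_density_integrable[OF order_refl borel_egg_box]]
    by (intro nn_integral_has_integral_lebesgue') (auto simp: integrable_integral, simp add: egg_density_def)
  moreover have "egg_box \<inter> egg_param m -` egg_boundary m = egg_box"
    using egg_param_in_boundary[OF m] by auto
  ultimately show "emeasure (egg_model m) (space (egg_model m)) \<noteq> \<infinity>"
    using closed_egg_boundary by (simp add: space_egg_model emeasure_egg_model[OF m])
qed

lemma fefferman_weight_integrable:
  assumes m: "m \<ge> 1" and B: "B \<in> sets (egg_model m)"
  shows "set_integrable (egg_model m) B (fefferman_weight (egg_rho m))"
  unfolding set_integrable_def
proof (rule finite_measure.integrable_const_bound[OF egg_model_finite[OF m]])
  show "(\<lambda>x. indicator B x *\<^sub>R fefferman_weight (egg_rho m) x) \<in> borel_measurable (egg_model m)"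
    using B borel_measurable_fefferman_weight[OF m] by simp
  show "AE x in egg_model m. norm (indicator B x *\<^sub>R fefferman_weight (egg_rho m) x) \<le> 2 * ((real m)\<^sup>2) powr (1/3)"
  proof (rule AE_I2)
    fix p assume "p \<in> space (egg_model m)"
    then have p: "p \<in> egg_boundary m" by (simp add: space_egg_model)
    have "egg_hess m p \<le> (real m)\<^sup>2 * 1"
      unfolding egg_hess_def using egg_boundary_le_1(2)[OF m p] by (intro mult_left_mono power_le_one) auto
    then have "2 * egg_hess m p powr (1/3) \<le> 2 * ((real m)\<^sup>2) powr (1/3)"
      by (intro mult_left_mono powr_mono2) (auto simp: egg_hess_nonneg)
    then have "fefferman_weight (egg_rho m) p \<le> 2 * ((real m)\<^sup>2) powr (1/3)"
      using fefferman_weight_bounds(2)[OF m p] by linarith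
    moreover have "0 \<le> egg_hess m p powr (1/3) / (2 * m)" by simp
    then have "0 \<le> fefferman_weight (egg_rho m) p"
      using fefferman_weight_bounds(1)[OF m p] by linarith
    ultimately show "norm (indicator B p *\<^sub>R fefferman_weight (egg_rho m) p) \<le> 2 * ((real m)\<^sup>2) powr (1/3)"
      by (auto simp: indicator_def)
  qed
qed

text \<open>By the lower bound the weight can vanish only where \<open>egg_hess\<close> does, and
  there the density of the measure vanishes too.\<close>

lemma fefferman_weight_pos_AE:
  assumes m: "m \<ge> 1"
  shows "AE p in egg_model m. 0 < fefferman_weight (egg_rho m) p"
proof -
  let ?Z = "{p \<in> egg_boundary m. fefferman_weight (egg_rho m) p \<le> 0}"
  have [measurable]: "fefferman_weight (egg_rho m) \<in> borel_measurable (egg_model m)"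
    by (rule borel_measurable_fefferman_weight[OF m])
  have Z: "?Z \<in> sets (egg_model m)"
    unfolding space_egg_model[symmetric] by measurable
  then have "?Z \<in> sets borel"
    using closed_egg_boundary by (simp add: sets_egg_model sets_restrict_space_iff)
  then have "emeasure (egg_model m) ?Z =
      (\<integral>\<^sup>+u\<in>egg_box \<inter> egg_param m -` ?Z. ennreal (egg_density m u) \<partial>lborel)"
    by (intro emeasure_egg_model[OF m]) auto
  also have "\<dots> = (\<integral>\<^sup>+(u :: real ^ 3). 0 \<partial>lborel)"
  proof (rule nn_integral_cong)
    fix u :: "real ^ 3"
    have "egg_density m u = 0" if "egg_param m u \<in> ?Z"
    proof -
      have "egg_hess m (egg_param m u) powr (1/3) / (2 * m) \<le> 0"
        using that fefferman_weight_bounds(1)[OF m, of "egg_param m u"] by simp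
      then have "egg_hess m (egg_param m u) powr (1/3) \<le> 0" using m by (simp add: divide_le_0_iff)
      then have "egg_hess m (egg_param m u) = 0" by (simp add: not_less[symmetric])
      then show ?thesis by (simp add: egg_hess_def egg_density_def egg_param_snd)
    qed
    then show "ennreal (egg_density m u) * indicator (egg_box \<inter> egg_param m -` ?Z) u = 0"
      by (auto simp: indicator_def)
  qed
  finally have "?Z \<in> null_sets (egg_model m)" using Z by auto
  then show ?thesis by (rule AE_I') (auto simp: space_egg_model not_less)
qed

text \<open>For h > 0 the product is at most a multiple of h / h^(1/3) = h^(2/3), which increases
  with h. For h = 0 the inverse weight is infinite, but the density is 0 and the product is 0 in
  \<open>ennreal\<close>.\<close>

lemma inverse_weight_times_density:
  assumes m: "m \<ge> 1" and u: "u \<in> egg_box" and eta: "egg_hess m (egg_param m u) \<le> \<eta>"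
  shows "inverse (ennreal (fefferman_weight (egg_rho m) (egg_param m u))) * ennreal (egg_density m u)
    \<le> ennreal (m * \<eta> powr (2/3) / pi\<^sup>2)"
proof -
  define h where "h = egg_hess m (egg_param m u)"
  define \<omega> where "\<omega> = fefferman_weight (egg_rho m) (egg_param m u)"
  have dens: "egg_density m u = h / (2 * pi\<^sup>2)"
    by (simp add: h_def egg_hess_def egg_density_def egg_param_snd)
  have h0: "0 \<le> h" by (simp add: h_def egg_hess_nonneg)
  show ?thesis
  proof (cases "h = 0")
    case True
    then show ?thesis by (simp add: dens)
  next
    case False
    then have h: "h > 0" using h0 by simp
    have lo: "h powr (1/3) / (2 * m) \<le> \<omega>"
      unfolding h_def \<omega>_def by (intro fefferman_weight_bounds(1)[OF m] egg_param_in_boundary[OF m u])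
    have pos: "0 < h powr (1/3) / (2 * m)" using h m by simp
    have "inverse (ennreal \<omega>) = ennreal (inverse \<omega>)" using lo pos by (intro inverse_ennreal) linarith
    also have "\<dots> \<le> ennreal (inverse (h powr (1/3) / (2 * m)))"
      using lo pos by (intro ennreal_leI le_imp_inverse_le)
    finally have "inverse (ennreal \<omega>) * ennreal (egg_density m u)
        \<le> ennreal (inverse (h powr (1/3) / (2 * m))) * ennreal (h / (2 * pi\<^sup>2))"
      unfolding dens by (intro mult_right_mono) auto
    also have "\<dots> = ennreal (m * (h / h powr (1/3)) / pi\<^sup>2)"
      using h by (subst ennreal_mult'[symmetric]) (auto simp: field_simps)
    also have "h / h powr (1/3) = h powr (2/3)"
      using h powr_diff[of h 1 "1/3"] by simp
    also have "ennreal (m * h powr (2/3) / pi\<^sup>2) \<le> ennreal (m * \<eta> powr (2/3) / pi\<^sup>2)"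
      using eta h0 unfolding h_def[symmetric]
      by (intro ennreal_leI divide_right_mono mult_left_mono powr_mono2) auto
    finally show ?thesis by (simp add: \<omega>_def)
  qed
qed

text \<open>The quotient of the pointwise bounds of the weight: |w| varies by a factor 2 in either
  direction, which costs 2^(2m-2) twice in the Hessian factor, and 4m is the quotient of the
  constants in \<open>fefferman_weight_bounds\<close>.\<close>

definition far_const :: "nat \<Rightarrow> real" where
  "far_const m = 4 * m * ((2 ^ (2 * m - 2)) * (2 ^ (2 * m - 2))) powr (1/3)"

lemma egg_average_far:
  fixes m :: nat and p r
  defines "B \<equiv> qball (egg_boundary m) (egg_dist m) p r" and "\<omega> \<equiv> fefferman_weight (egg_rho m)"
  defines "V \<equiv> emeasure (egg_model m) B"
  assumes m: "m \<ge> 1" and p: "p \<in> egg_boundary m" and r: "0 < r" "8 * r \<le> cmod (p $ 2) ^ (2 * m)"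
    and V: "0 < V" "V < \<infinity>"
  shows "(\<integral>\<^sup>+x\<in>B. ennreal (\<omega> x) \<partial>egg_model m) / V *
    ((\<integral>\<^sup>+x\<in>B. inverse (ennreal (\<omega> x)) \<partial>egg_model m) / V) \<le> ennreal (far_const m)"
proof -
  define N where "N = 2 * m - 2"
  define a where "a = cmod (p $ 2)"
  define h where "h = (real m)\<^sup>2 * a ^ N"
  define hi where "hi = 2 * (2 ^ N * h) powr (1/3)"
  define lo where "lo = (h / 2 ^ N) powr (1/3) / (2 * m)"
  have B: "B \<in> sets (egg_model m)"
    unfolding B_def using closed_egg_boundary borel_egg_ball
    by (auto simp: sets_egg_model sets_restrict_space_iff qball_def)
  have "a \<noteq> 0" using r m by (auto simp: a_def power_0_left)
  then have a: "a > 0" by (simp add: a_def)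
  then have h: "h > 0" using m by (simp add: h_def)
  then have lo: "lo > 0" using m by (simp add: lo_def)
  have bounds: "lo \<le> \<omega> x" "\<omega> x \<le> hi" if "x \<in> B" for x
  proof -
    have x: "x \<in> egg_boundary m" "egg_dist m p x < r" using that by (auto simp: B_def qball_def)
    have far: "a / 2 \<le> cmod (x $ 2)" "cmod (x $ 2) \<le> 2 * a"
      using egg_dist_far[OF m x(2) r(2,1)] by (auto simp: a_def)
    have "(real m)\<^sup>2 * (a / 2) ^ N \<le> egg_hess m x"
      unfolding egg_hess_def N_def[symmetric] using far a by (intro mult_left_mono power_mono) auto
    then have 1: "h / 2 ^ N \<le> egg_hess m x" by (simp add: h_def power_divide)
    have "egg_hess m x \<le> (real m)\<^sup>2 * (2 * a) ^ N"
      unfolding egg_hess_def N_def[symmetric] using far a by (intro mult_left_mono power_mono) auto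
    then have 2: "egg_hess m x \<le> 2 ^ N * h" by (simp add: h_def power_mult_distrib mult_ac)
    have "lo \<le> egg_hess m x powr (1/3) / (2 * m)"
      unfolding lo_def using 1 h by (intro divide_right_mono powr_mono2) auto
    then show "lo \<le> \<omega> x"
      using fefferman_weight_bounds(1)[OF m x(1)] by (simp add: \<omega>_def)
    have "2 * egg_hess m x powr (1/3) \<le> hi"
      unfolding hi_def using 2 by (intro mult_left_mono powr_mono2) (auto simp: egg_hess_nonneg)
    then show "\<omega> x \<le> hi"
      using fefferman_weight_bounds(2)[OF m x(1)] by (simp add: \<omega>_def)
  qed
  have "(\<integral>\<^sup>+x\<in>B. ennreal (\<omega> x) \<partial>egg_model m) \<le> (\<integral>\<^sup>+x\<in>B. ennreal hi \<partial>egg_model m)"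
    using bounds by (intro nn_integral_mono) (auto simp: indicator_def intro!: ennreal_leI)
  also have "\<dots> = ennreal hi * V" using B by (simp add: V_def nn_integral_cmult_indicator)
  finally have I: "(\<integral>\<^sup>+x\<in>B. ennreal (\<omega> x) \<partial>egg_model m) \<le> ennreal hi * V" .
  have "inverse (ennreal (\<omega> x)) \<le> ennreal (inverse lo)" if "x \<in> B" for x
  proof -
    have "inverse (ennreal (\<omega> x)) = ennreal (inverse (\<omega> x))"
      using bounds[OF that] lo by (intro inverse_ennreal) linarith
    then show ?thesis using bounds[OF that] lo by (simp add: ennreal_leI le_imp_inverse_le)
  qed
  then have "(\<integral>\<^sup>+x\<in>B. inverse (ennreal (\<omega> x)) \<partial>egg_model m) \<le> (\<integral>\<^sup>+x\<in>B. ennreal (inverse lo) \<partial>egg_model m)"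
    by (intro nn_integral_mono) (auto simp: indicator_def)
  also have "\<dots> = ennreal (inverse lo) * V" using B by (simp add: V_def nn_integral_cmult_indicator)
  finally have J: "(\<integral>\<^sup>+x\<in>B. inverse (ennreal (\<omega> x)) \<partial>egg_model m) \<le> ennreal (inverse lo) * V" .
  have "hi * inverse lo = 4 * m * ((2 ^ N * h) powr (1/3) / (h / 2 ^ N) powr (1/3))"
    using m h by (simp add: hi_def lo_def field_simps)
  also have "(2 ^ N * h) powr (1/3) / (h / 2 ^ N) powr (1/3) = ((2 ^ N * h) / (h / 2 ^ N)) powr (1/3)"
    by (rule powr_divide[symmetric])
  also have "(2 ^ N * h) / (h / 2 ^ N) = 2 ^ N * (2 ^ N)" using h by simp
  finally have c: "hi * inverse lo = far_const m" by (simp add: far_const_def N_def)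
  have "0 \<le> hi" by (simp add: hi_def)
  from ennreal_average_product_le[OF V I J this] show ?thesis by (simp only: c)
qed

text \<open>What remains of 2 eta^(1/3) b L / v in \<open>egg_average_near\<close> after cancelling
  the powers of s, min(r, 1), pi and m common to both sides. Here c s is the least |w| guaranteed on
  the box of \<open>egg_model_ball_lower\<close>, and 3 * 256 * 2 comes from the three boxes of
  \<open>egg_ball_volume_upper\<close>.\<close>

definition near_const :: "nat \<Rightarrow> real" where
  "near_const m = (let c = 1 / (4 * (48 * real m * 100 ^ m)) in
    2 * real m * 8 ^ (2 * m - 2) * (3 * 256 * 2 * (2 * pi * (1 + 2 * real m * 64 ^ m))) * 2 * 8 / (c ^ (2 * m - 2) * c\<^sup>2))"

lemma egg_average_near:
  fixes m :: nat and p r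
  defines "B \<equiv> qball (egg_boundary m) (egg_dist m) p r" and "\<omega> \<equiv> fefferman_weight (egg_rho m)"
  defines "V \<equiv> emeasure (egg_model m) B"
  assumes m: "m \<ge> 1" and p: "p \<in> egg_boundary m" and r: "0 < r" "cmod (p $ 2) ^ (2 * m) < 8 * r"
    and V: "0 < V" "V < \<infinity>"
  shows "(\<integral>\<^sup>+x\<in>B. ennreal (\<omega> x) \<partial>egg_model m) / V *
    ((\<integral>\<^sup>+x\<in>B. inverse (ennreal (\<omega> x)) \<partial>egg_model m) / V) \<le> ennreal (near_const m)"
proof -
  define N where "N = 2 * m - 2"
  define r' where "r' = min r 1"
  define s where "s = root (2 * m) r'"
  define \<eta> where "\<eta> = (real m)\<^sup>2 * (8 * s) ^ N"
  define K where "K = 2 * pi * (1 + 2 * real m * 64 ^ m)"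
  define L where "L = 3 * ((16 * s)\<^sup>2 * (2 * (K * r')))"
  define c where "c = 1 / (4 * (48 * real m * 100 ^ m))"
  define v where "v = (real m)\<^sup>2 * (c * s) ^ N / (2 * pi\<^sup>2) * ((c * s)\<^sup>2 * (r' / 8))"
  define b where "b = m * \<eta> powr (2/3) / pi\<^sup>2"
  have r': "r' > 0" using r by (simp add: r'_def)
  have s: "0 < s" "s ^ (2 * m) = min r 1"
    using r' m by (auto simp: s_def real_root_pow_pos2 r'_def)
  have B [measurable]: "B \<in> sets (egg_model m)"
    unfolding B_def using closed_egg_boundary borel_egg_ball
    by (auto simp: sets_egg_model sets_restrict_space_iff qball_def)
  have x: "x \<in> egg_boundary m" "egg_dist m p x < r" if "x \<in> B" for x
    using that by (auto simp: B_def qball_def)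
  have near: "cmod (x $ 2) \<le> 8 * s" if "x \<in> B" for x
    using egg_dist_near(2)[OF m p x[OF that] r(2) s] .
  \<comment> \<open>The bound on |w_0| in \<open>egg_dist_near\<close> needs a witness in the ball;
    positive measure supplies one.\<close>
  have "B \<noteq> {}" using V by (auto simp: V_def)
  then obtain q where "q \<in> B" by blast
  then have nearp: "cmod (p $ 2) \<le> 8 * s"
    using egg_dist_near(1)[OF m p x r(2) s] by blast
  have \<eta>: "\<eta> > 0" using s m by (simp add: \<eta>_def)
  have hess: "egg_hess m x \<le> \<eta>" if "x \<in> B" for x
    unfolding egg_hess_def \<eta>_def N_def[symmetric] using near[OF that] s
    by (intro mult_left_mono power_mono) auto
  have c: "c > 0" using m by (simp add: c_def)
  have v: "v > 0" using c s r' m by (simp add: v_def)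
  have "c * s = (s / (48 * real m * 100 ^ m)) / 4" by (simp add: c_def)
  then have Vv: "ennreal v \<le> V"
    using egg_model_ball_lower[OF m p nearp s] by (simp add: v_def V_def B_def N_def r'_def)
  have "(\<integral>\<^sup>+x\<in>B. ennreal (\<omega> x) \<partial>egg_model m) \<le> (\<integral>\<^sup>+x\<in>B. ennreal (2 * \<eta> powr (1/3)) \<partial>egg_model m)"
  proof (intro nn_integral_mono)
    fix y
    have "\<omega> y \<le> 2 * \<eta> powr (1/3)" if "y \<in> B"
    proof -
      have "2 * egg_hess m y powr (1/3) \<le> 2 * \<eta> powr (1/3)"
        using hess[OF that] by (intro mult_left_mono powr_mono2) (auto simp: egg_hess_nonneg)
      then show ?thesis using fefferman_weight_bounds(2)[OF m x(1)[OF that]] by (simp add: \<omega>_def)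
    qed
    then show "ennreal (\<omega> y) * indicator B y \<le> ennreal (2 * \<eta> powr (1/3)) * indicator B y"
      by (auto simp: indicator_def intro!: ennreal_leI)
  qed
  also have "\<dots> = ennreal (2 * \<eta> powr (1/3)) * V"
    using B by (simp add: V_def nn_integral_cmult_indicator)
  finally have I: "(\<integral>\<^sup>+x\<in>B. ennreal (\<omega> x) \<partial>egg_model m) \<le> ennreal (2 * \<eta> powr (1/3)) * V" .
  have [measurable]: "\<omega> \<in> borel_measurable (egg_model m)"
    unfolding \<omega>_def by (rule borel_measurable_fefferman_weight[OF m])
  \<comment> \<open>For m > 1 the inverse weight has no pointwise bound near w = 0, so the integral
    is moved to coordinates, where the density tames it.\<close>
  have "(\<integral>\<^sup>+x\<in>B. inverse (ennreal (\<omega> x)) \<partial>egg_model m) =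
      (\<integral>\<^sup>+u\<in>egg_box. inverse (ennreal (\<omega> (egg_param m u))) * indicator B (egg_param m u) * ennreal (egg_density m u) \<partial>lborel)"
    by (intro nn_integral_egg_model[OF m]) measurable
  also have "\<dots> \<le> (\<integral>\<^sup>+u. ennreal b * indicator (egg_box \<inter> egg_param m -` B) u \<partial>lborel)"
    using inverse_weight_times_density[OF m _ hess]
    by (intro nn_integral_mono) (auto simp: indicator_def b_def \<omega>_def)
  also have "\<dots> = ennreal b * emeasure lborel (egg_box \<inter> egg_param m -` B)"
    using measurable_sets[OF borel_measurable_egg_param borel_egg_ball] borel_egg_box
    by (intro nn_integral_cmult_indicator) (auto simp: B_def)
  also have "\<dots> \<le> ennreal b * ennreal L"
    using egg_ball_volume_upper[OF m p nearp near[unfolded B_def] s]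
    by (intro mult_left_mono) (auto simp: L_def K_def B_def r'_def)
  also have "\<dots> = ennreal (b * L / v) * ennreal v"
  proof -
    have "0 \<le> b" by (simp add: b_def)
    then have "ennreal b * ennreal L = ennreal (b * L / v * v)"
      using v by (simp add: ennreal_mult')
    also have "\<dots> = ennreal (b * L / v) * ennreal v"
      using v by (intro ennreal_mult'') simp
    finally show ?thesis .
  qed
  also have "\<dots> \<le> ennreal (b * L / v) * V" using Vv by (rule mult_left_mono) simp
  finally have J: "(\<integral>\<^sup>+x\<in>B. inverse (ennreal (\<omega> x)) \<partial>egg_model m) \<le> ennreal (b * L / v) * V" .
  have "2 * \<eta> powr (1/3) * b = 2 * real m * (\<eta> powr (1/3) * \<eta> powr (2/3)) / pi\<^sup>2" by (simp add: b_def)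
  also have "\<eta> powr (1/3) * \<eta> powr (2/3) = \<eta>" using \<eta> by (simp flip: powr_add)
  finally have ab: "2 * \<eta> powr (1/3) * b = 2 * real m * \<eta> / pi\<^sup>2" .
  have "2 * \<eta> powr (1/3) * (b * L / v) = (2 * \<eta> powr (1/3) * b) * L / v" by simp
  also have "\<dots> = 2 * real m * \<eta> / pi\<^sup>2 * L / v" by (simp only: ab)
  also have "\<dots> = near_const m"
  proof -
    have "v = (real m)\<^sup>2 / pi\<^sup>2 * s ^ N * s\<^sup>2 * r' * (c ^ N * c\<^sup>2) / (2 * 8)"
      by (simp add: v_def power_mult_distrib mult_ac)
    moreover have "2 * real m * \<eta> / pi\<^sup>2 * L = (2 * real m * 8 ^ N * (3 * 256 * 2 * K)) * ((real m)\<^sup>2 / pi\<^sup>2 * s ^ N * s\<^sup>2 * r')"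
      by (simp add: \<eta>_def L_def power_mult_distrib mult_ac)
    moreover have "(real m)\<^sup>2 / pi\<^sup>2 * s ^ N * s\<^sup>2 * r' \<noteq> 0" using m s r' by simp
    moreover have "c ^ N * c\<^sup>2 \<noteq> 0" using c by simp
    moreover have "x * z / (z * y / (2 * 8)) = x * 2 * 8 / y" if "z \<noteq> 0" "y \<noteq> 0" for x y z :: real
      using that by (simp add: field_simps)
    ultimately have "2 * real m * \<eta> / pi\<^sup>2 * L / v = (2 * real m * 8 ^ N * (3 * 256 * 2 * K)) * 2 * 8 / (c ^ N * c\<^sup>2)"
      by metis
    then show ?thesis by (simp only: near_const_def Let_def K_def N_def c_def)
  qed
  finally have C: "2 * \<eta> powr (1/3) * (b * L / v) = near_const m" .
  have "0 \<le> 2 * \<eta> powr (1/3)" by simp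
  from ennreal_average_product_le[OF V I J this] show ?thesis by (simp only: C)
qed

theorem theorem1p1:
  fixes m :: nat
  assumes "m \<ge> 1"
  shows "fefferman_weight (egg_rho m)
           \<in> muckenhoupt_A2 (frontier (egg_domain m)) (egg_dist m) (egg_S m)"
  unfolding muckenhoupt_A2_def egg_frontier[OF assms] egg_S_eq_model[OF assms] mem_Collect_eq
proof (intro conjI ballI allI impI)
  show "0 \<le> fefferman_weight (egg_rho m) p" if "p \<in> egg_boundary m" for p
    using fefferman_weight_bounds(1)[OF assms that] order_trans[of 0 "egg_hess m p powr (1/3) / (2 * m)"]
    by simp
  show "fefferman_weight (egg_rho m) \<in> borel_measurable (egg_model m)"
    by (rule borel_measurable_fefferman_weight[OF assms])
  show "set_integrable (egg_model m) (qball (egg_boundary m) (egg_dist m) p r) (fefferman_weight (egg_rho m))" for p r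
    using closed_egg_boundary borel_egg_ball
    by (intro fefferman_weight_integrable[OF assms])
       (auto simp: sets_egg_model sets_restrict_space_iff qball_def)
  show "AE p in egg_model m. 0 < fefferman_weight (egg_rho m) p"
    by (rule fefferman_weight_pos_AE[OF assms])
  let ?C = "max (ennreal (far_const m)) (ennreal (near_const m))"
  have "(\<integral>\<^sup>+x\<in>B. ennreal (fefferman_weight (egg_rho m) x) \<partial>egg_model m) / emeasure (egg_model m) B *
      ((\<integral>\<^sup>+x\<in>B. inverse (ennreal (fefferman_weight (egg_rho m) x)) \<partial>egg_model m) / emeasure (egg_model m) B) \<le> ?C"
    if "B \<in> {qball (egg_boundary m) (egg_dist m) x r |x r. x \<in> egg_boundary m \<and> 0 < r \<and>
      0 < emeasure (egg_model m) (qball (egg_boundary m) (egg_dist m) x r) \<and>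
      emeasure (egg_model m) (qball (egg_boundary m) (egg_dist m) x r) < \<infinity>}" for B
  proof -
    obtain p r where B: "B = qball (egg_boundary m) (egg_dist m) p r" and p: "p \<in> egg_boundary m" "0 < r"
      and V: "0 < emeasure (egg_model m) B" "emeasure (egg_model m) B < \<infinity>"
      using \<open>B \<in> _\<close> by auto
    show ?thesis
    proof (cases "8 * r \<le> cmod (p $ 2) ^ (2 * m)")
      case True
      show ?thesis
        using egg_average_far[OF assms p True V[unfolded B]] unfolding B
        by (rule order_trans) simp
    next
      case False
      then have "cmod (p $ 2) ^ (2 * m) < 8 * r" by simp
      from egg_average_near[OF assms p this V[unfolded B]] show ?thesis
        unfolding B by (rule order_trans) simp
    qed
  qed
  then have "(SUP B \<in> {qball (egg_boundary m) (egg_dist m) x r |x r. x \<in> egg_boundary m \<and> 0 < r \<and>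
      0 < emeasure (egg_model m) (qball (egg_boundary m) (egg_dist m) x r) \<and>
      emeasure (egg_model m) (qball (egg_boundary m) (egg_dist m) x r) < \<infinity>}.
      (\<integral>\<^sup>+x\<in>B. ennreal (fefferman_weight (egg_rho m) x) \<partial>egg_model m) / emeasure (egg_model m) B *
      ((\<integral>\<^sup>+x\<in>B. inverse (ennreal (fefferman_weight (egg_rho m) x)) \<partial>egg_model m) / emeasure (egg_model m) B)) \<le> ?C"
    by (rule SUP_least)
  also have "?C < \<infinity>" by (simp add: max_def)
  finally show "(SUP B \<in> {qball (egg_boundary m) (egg_dist m) x r |x r. x \<in> egg_boundary m \<and> 0 < r \<and>
      0 < emeasure (egg_model m) (qball (egg_boundary m) (egg_dist m) x r) \<and>
      emeasure (egg_model m) (qball (egg_boundary m) (egg_dist m) x r) < \<infinity>}.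
      (\<integral>\<^sup>+x\<in>B. ennreal (fefferman_weight (egg_rho m) x) \<partial>egg_model m) / emeasure (egg_model m) B *
      ((\<integral>\<^sup>+x\<in>B. inverse (ennreal (fefferman_weight (egg_rho m) x)) \<partial>egg_model m) / emeasure (egg_model m) B)) < \<infinity>" .
qed

end
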